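(* Let $g,h\in\mathbb{Z}^+$, let $\Omega\subseteq M(\mathbb{C})^g$ be a connected free domain and let $T:\Omega\times M(\mathbb{C})^g\to M(\mathbb{C})^h$ be an analytic free vector field. Then $T$ is free-curl free if and only if there exists an analytic free map $f:\Omega\to M(\mathbb{C})^h$ such that $T(X,H)=Df(X)[H]$ for all $n\in\mathbb{Z}^+$, $X\in\Omega[n]$ and $H\in M_n(\mathbb{C})^g$.
   Context: Notation: $M(\mathbb{C})^g=(M_n(\mathbb{C})^g)_{n\ge 1}$ is the sequence of spaces of $g$-tuples of $n\times n$ complex matrices. A subset $\Omega\subseteq M(\mathbb{C})^g$ is a sequence $(\Omega[n])_{n\ge1}$ with $\Omega[n]\subseteq M_n(\mathbb{C})^g$ (some $\Omega[n]$ may be empty). It is a free set if for all $m,n$, $X\in\Omega[n]$, $Y\in\Omega[m]$, $S\in \mathrm{GL}_n(\mathbb{C})$: $X\oplus Y=(X_1\oplus Y_1,\dots,X_g\oplus Y_g)\in\Omega[n+m]$ (block diagonal direct sums) and $S^{-1}XS=(S^{-1}X_1S,\dots,S^{-1}X_gS)\in\Omega[n]$. A free domain is a free set with every $\Omega[n]$ open in $M_n(\mathbb{C})^g$. It is connected if every nonempty $\Omega[n]$ is connected. $\Omega\times M(\mathbb{C})^g$ denotes the free set $(\Omega[n]\times M_n(\mathbb{C})^g)_{n\ge1}$. A map $f:\Omega\to M(\mathbb{C})^h$ is a sequence $f[n]:\Omega[n]\to M_n(\mathbb{C})^h$. It is a free map if $f(X\oplus Y)=f(X)\oplus f(Y)$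 and $f(S^{-1}XS)=S^{-1}f(X)S$ for all $X\in\Omega[n]$, $Y\in\Omega[m]$, $S\in\mathrm{GL}_n(\mathbb{C})$; it is analytic if each $f[n]$ is analytic. The derivative is $Df(X)[H]=\lim_{z\to0}\frac{f(X+zH)-f(X)}{z}$ for $X\in\Omega[n]$, $H\in M_n(\mathbb{C})^g$. A free vector field is a free map $T:\Omega\times M(\mathbb{C})^g\to M(\mathbb{C})^h$ that is linear in its second argument: $T(X,cH+K)=cT(X,H)+T(X,K)$ for $X\in\Omega[n]$, $H,K\in M_n(\mathbb{C})^g$, $c\in\mathbb{C}$. If $T$ is analytic, $DT(X,H)[K,L]$ denotes its derivative at the point $(X,H)$ in the direction $(K,L)$. An analytic free vector field $T$ is free-curl free if $DT(X,H)[K,0]=DT(X,K)[H,0]$ for all $n$, $X\in\Omega[n]$ and $H,K\in M_n(\mathbb{C})^g$. *)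

theory Defs
  imports "HOL-Analysis.Analysis" "Jordan_Normal_Form.Matrix"
begin

text \<open>The number \<open>g\<close> of matrices in a tuple is the cardinality of a finite (hence nonempty) index
  type \<open>'g\<close>; the matrix size \<open>n\<close>, which varies inside the statements, is a natural number. All
  level-indexed families have index type \<^typ>\<open>nat\<close>, but only the levels \<open>n > 0\<close> are ever
  constrained or used.\<close>

type_synonym 'g mtuple = "'g \<Rightarrow> complex mat"

definition mtuples :: "nat \<Rightarrow> 'g mtuple set" where
  "mtuples n = {X. \<forall>i. X i \<in> carrier_mat n n}"

definition tuple_zero :: "nat \<Rightarrow> 'g mtuple" where
  "tuple_zero n = (\<lambda>_. 0\<^sub>m n n)"

definition tuple_add :: "'g mtuple \<Rightarrow> 'g mtuple \<Rightarrow> 'g mtuple" where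
  "tuple_add X Y = (\<lambda>i. X i + Y i)"

definition tuple_diff :: "'g mtuple \<Rightarrow> 'g mtuple \<Rightarrow> 'g mtuple" where
  "tuple_diff X Y = (\<lambda>i. X i - Y i)"

definition tuple_scale :: "complex \<Rightarrow> 'g mtuple \<Rightarrow> 'g mtuple" where
  "tuple_scale c X = (\<lambda>i. c \<cdot>\<^sub>m X i)"

definition tuple_dsum :: "'g mtuple \<Rightarrow> 'g mtuple \<Rightarrow> 'g mtuple" where
  "tuple_dsum X Y = (\<lambda>i. four_block_mat (X i) (0\<^sub>m (dim_row (X i)) (dim_col (Y i)))
                                        (0\<^sub>m (dim_row (Y i)) (dim_col (X i))) (Y i))"

text \<open>\<open>GL_pairs n\<close> consists of the pairs \<open>(S, S\<^sup>-\<^sup>1)\<close> with \<open>S\<close> in \<open>GL\<^sub>n(\<complex>)\<close>.\<close>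

definition GL_pairs :: "nat \<Rightarrow> (complex mat \<times> complex mat) set" where
  "GL_pairs n = {(S, S'). S \<in> carrier_mat n n \<and> S' \<in> carrier_mat n n \<and>
                          inverts_mat S S' \<and> inverts_mat S' S}"

definition tuple_conj :: "complex mat \<times> complex mat \<Rightarrow> 'g mtuple \<Rightarrow> 'g mtuple" where
  "tuple_conj P X = (\<lambda>i. snd P * X i * fst P)"

text \<open>Type \<^typ>\<open>'a mat\<close> carries no topology. We pull back the product topology along the matrix
  entries, which gives the Euclidean topology of \<open>\<complex>\<close> to the power \<open>g n\<^sup>2\<close>.
  Entries outside the \<open>n \<times> n\<close> range are unspecified for \<^typ>\<open>'a mat\<close> and are set to 0.\<close>

definition entries :: "nat \<Rightarrow> 'g mtuple \<Rightarrow> 'g \<times> nat \<times> nat \<Rightarrow> complex" where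
  "entries n X = (\<lambda>(i, r, c). if r < n \<and> c < n then X i $$ (r, c) else 0)"

definition tuple_topology :: "nat \<Rightarrow> 'g mtuple topology" where
  "tuple_topology n = pullback_topology (mtuples n) (entries n) euclidean"

definition free_set :: "(nat \<Rightarrow> 'g::finite mtuple set) \<Rightarrow> bool" where
  "free_set \<Omega> \<longleftrightarrow>
     (\<forall>n>0. \<Omega> n \<subseteq> mtuples n) \<and>
     (\<forall>n>0. \<forall>m>0. \<forall>X\<in>\<Omega> n. \<forall>Y\<in>\<Omega> m. tuple_dsum X Y \<in> \<Omega> (n + m)) \<and>
     (\<forall>n>0. \<forall>X\<in>\<Omega> n. \<forall>P\<in>GL_pairs n. tuple_conj P X \<in> \<Omega> n)"

definition free_domain :: "(nat \<Rightarrow> 'g::finite mtuple set) \<Rightarrow> bool" where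
  "free_domain \<Omega> \<longleftrightarrow> free_set \<Omega> \<and> (\<forall>n>0. openin (tuple_topology n) (\<Omega> n))"

definition connected_free :: "(nat \<Rightarrow> 'g::finite mtuple set) \<Rightarrow> bool" where
  "connected_free \<Omega> \<longleftrightarrow> (\<forall>n>0. \<Omega> n \<noteq> {} \<longrightarrow> connectedin (tuple_topology n) (\<Omega> n))"

definition free_map ::
  "(nat \<Rightarrow> 'g::finite mtuple set) \<Rightarrow> (nat \<Rightarrow> 'g mtuple \<Rightarrow> 'h::finite mtuple) \<Rightarrow> bool" where
  "free_map \<Omega> f \<longleftrightarrow>
     (\<forall>n>0. \<forall>X\<in>\<Omega> n. f n X \<in> mtuples n) \<and>
     (\<forall>n>0. \<forall>m>0. \<forall>X\<in>\<Omega> n. \<forall>Y\<in>\<Omega> m.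
        f (n + m) (tuple_dsum X Y) = tuple_dsum (f n X) (f m Y)) \<and>
     (\<forall>n>0. \<forall>X\<in>\<Omega> n. \<forall>P\<in>GL_pairs n. f n (tuple_conj P X) = tuple_conj P (f n X))"

text \<open>Analyticity on \<open>\<Omega>\<close>: around every point, each entry of \<open>f n\<close> is the sum of a convergent
  power series in the \<open>g n\<^sup>2\<close> matrix entries of the argument; \<open>multi_indices n\<close> are the
  multi-exponents of its monomials.\<close>

definition multi_indices :: "nat \<Rightarrow> ('g \<times> nat \<times> nat \<Rightarrow> nat) set" where
  "multi_indices n = {\<alpha>. \<forall>p. p \<notin> UNIV \<times> {..<n} \<times> {..<n} \<longrightarrow> \<alpha> p = 0}"

definition analytic_free ::
  "(nat \<Rightarrow> 'g::finite mtuple set) \<Rightarrow> (nat \<Rightarrow> 'g mtuple \<Rightarrow> 'h::finite mtuple) \<Rightarrow> bool" where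
  "analytic_free \<Omega> f \<longleftrightarrow>
     (\<forall>n>0. \<forall>A\<in>\<Omega> n. \<forall>q\<in>UNIV \<times> {..<n} \<times> {..<n}.
        \<exists>V a. openin (tuple_topology n) V \<and> A \<in> V \<and> V \<subseteq> \<Omega> n \<and>
          (\<forall>X\<in>V. ((\<lambda>\<alpha>. a \<alpha> * (\<Prod>p\<in>UNIV \<times> {..<n} \<times> {..<n}. (entries n X p - entries n A p) ^ \<alpha> p))
                    has_sum entries n (f n X) q) (multi_indices n)))"

definition free_deriv ::
  "(nat \<Rightarrow> 'g mtuple \<Rightarrow> 'h mtuple) \<Rightarrow> nat \<Rightarrow> 'g mtuple \<Rightarrow> 'g mtuple \<Rightarrow> 'h mtuple" where
  "free_deriv f n X H =
     (THE L. limitin (tuple_topology n)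
        (\<lambda>z. tuple_scale (1 / z) (tuple_diff (f n (tuple_add X (tuple_scale z H))) (f n X)))
        L (at (0::complex)))"

text \<open>A pair \<open>(X, H)\<close> of a \<open>g\<close>-tuple and a \<open>k\<close>-tuple is the \<open>(g + k)\<close>-tuple
  \<open>case_sum X H\<close> indexed by the sum type, so that the notions above apply to
  \<open>\<Omega> \<times> M(\<complex>)\<^sup>g\<close>.\<close>

abbreviation tuple_pair :: "'g mtuple \<Rightarrow> 'k mtuple \<Rightarrow> ('g + 'k) mtuple" where
  "tuple_pair X H \<equiv> case_sum X H"

definition times_mtuples :: "(nat \<Rightarrow> 'g mtuple set) \<Rightarrow> nat \<Rightarrow> ('g + 'g) mtuple set" where
  "times_mtuples \<Omega> n = {tuple_pair X H |X H. X \<in> \<Omega> n \<and> H \<in> mtuples n}"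

definition free_vector_field ::
  "(nat \<Rightarrow> 'g::finite mtuple set) \<Rightarrow> (nat \<Rightarrow> ('g + 'g) mtuple \<Rightarrow> 'h::finite mtuple) \<Rightarrow> bool" where
  "free_vector_field \<Omega> T \<longleftrightarrow>
     free_map (times_mtuples \<Omega>) T \<and>
     (\<forall>n>0. \<forall>X\<in>\<Omega> n. \<forall>H\<in>mtuples n. \<forall>K\<in>mtuples n. \<forall>c.
        T n (tuple_pair X (tuple_add (tuple_scale c H) K)) =
        tuple_add (tuple_scale c (T n (tuple_pair X H))) (T n (tuple_pair X K)))"

definition free_curl_free ::
  "(nat \<Rightarrow> 'g::finite mtuple set) \<Rightarrow> (nat \<Rightarrow> ('g + 'g) mtuple \<Rightarrow> 'h::finite mtuple) \<Rightarrow> bool" where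
  "free_curl_free \<Omega> T \<longleftrightarrow>
     (\<forall>n>0. \<forall>X\<in>\<Omega> n. \<forall>H\<in>mtuples n. \<forall>K\<in>mtuples n.
        free_deriv T n (tuple_pair X H) (tuple_pair K (tuple_zero n)) =
        free_deriv T n (tuple_pair X K) (tuple_pair H (tuple_zero n)))"

end

theory Submission
  imports Defs
begin

text \<open>For a free map \<open>F\<close>, the derivative \<open>DF(X)[H]\<close> is the upper right block of \<open>F\<close> at the block matrix
  with rows \<open>X, H\<close> and \<open>0, X\<close>. Hence if \<open>T = Df\<close>, then \<open>DT(X,H)[K,0]\<close> is the corner of \<open>f\<close> at a
  \<open>4 \<times> 4\<close> block matrix, and exchanging the two middle blocks swaps \<open>H\<close> and \<open>K\<close>.

  Conversely, no integration is needed. Put \<open>\<Delta>(X,Y)(W) = T(X \<oplus> Y, E\<^sub>1\<^sub>2 \<otimes> (XW - WY))\<^sub>1\<^sub>2\<close>; a potential \<open>f\<close> must satisfy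
  \<open>f(X)W - W f(Y) = \<Delta>(X,Y)(W)\<close>. The vanishing of the free curl at \<open>X \<oplus> Y \<oplus> Z\<close> in the directions
  \<open>E\<^sub>1\<^sub>2 \<otimes> (XU - UY)\<close> and \<open>E\<^sub>2\<^sub>3 \<otimes> (YV - VZ)\<close> says exactly that \<open>\<Delta>\<close> is a derivation,
  \<open>\<Delta>(X,Z)(UV) = U \<Delta>(Y,Z)(V) + \<Delta>(X,Y)(U) V\<close>. Since the points of \<open>\<Omega>\<close> with all rectangular matrices
  as morphisms form a category equivalent to that of finite-dimensional vector spaces, \<open>\<Delta>\<close> is inner:
  for a fixed \<open>Z\<^sub>0\<close> in \<open>\<Omega>\<close> the matrix \<open>f(X)\<close> whose \<open>k\<close>-th column is the first column of
  \<open>\<Delta>(X,Z\<^sub>0)(E\<^sub>k\<^sub>1)\<close> works. Freeness, analyticity and \<open>Df = T\<close> are read off from these formulas.\<close>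

subsection \<open>Block matrices\<close>

text \<open>Conditional rewriting with side conditions on dimensions that the simplifier can discharge; the
  carrier-based rules of the library leave an inner dimension to be guessed.\<close>

lemma mult_assoc_dim:
  fixes A :: "'a::semiring_0 mat"
  assumes "dim_col A = dim_row B" "dim_col B = dim_row C"
  shows "A * (B * C) = A * B * C"
  using assms by (intro assoc_mult_mat[symmetric]) auto

lemma add_mult_dim:
  fixes A :: "'a::semiring_0 mat"
  assumes "dim_row A = dim_row B" "dim_col A = dim_row C" "dim_col B = dim_row C"
  shows "(A + B) * C = A * C + B * C"
  using assms by (intro add_mult_distrib_mat) auto

lemma mult_add_dim:
  fixes A :: "'a::semiring_0 mat"
  assumes "dim_col A = dim_row B" "dim_col B = dim_col C" "dim_row B = dim_row C"
  shows "A * (B + C) = A * B + A * C"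
  using assms by (intro mult_add_distrib_mat) auto

lemma minus_mult_dim:
  fixes A :: "'a::ring mat"
  assumes "dim_row A = dim_row B" "dim_col A = dim_row C" "dim_col B = dim_row C"
  shows "(A - B) * C = A * C - B * C"
  using assms by (intro minus_mult_distrib_mat) auto

lemma mult_minus_dim:
  fixes A :: "'a::ring mat"
  assumes "dim_col A = dim_row B" "dim_col B = dim_col C" "dim_row B = dim_row C"
  shows "A * (B - C) = A * B - A * C"
  using assms by (intro mult_minus_distrib_mat) auto

lemma smult_mult_dim:
  fixes A :: "'a::comm_semiring_0 mat"
  assumes "dim_col A = dim_row B"
  shows "(c \<cdot>\<^sub>m A) * B = c \<cdot>\<^sub>m (A * B)" "A * (c \<cdot>\<^sub>m B) = c \<cdot>\<^sub>m (A * B)"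
  using assms by (auto intro!: mult_smult_assoc_mat mult_smult_distrib)

lemma mult_zero_dim:
  fixes A :: "'a::semiring_0 mat"
  shows "dim_row A = k \<Longrightarrow> 0\<^sub>m n k * A = 0\<^sub>m n (dim_col A)"
    and "dim_col A = k \<Longrightarrow> A * 0\<^sub>m k n = 0\<^sub>m (dim_row A) n"
  by auto

lemma mult_one_dim:
  fixes A :: "'a::semiring_1 mat"
  shows "dim_row A = k \<Longrightarrow> 1\<^sub>m k * A = A"
    and "dim_col A = k \<Longrightarrow> A * 1\<^sub>m k = A"
  by auto

lemma add_zero_dim:
  fixes A :: "'a::group_add mat"
  assumes "dim_row A = n" "dim_col A = m"
  shows "0\<^sub>m n m + A = A" "A + 0\<^sub>m n m = A" "A - 0\<^sub>m n m = A" "A - A = 0\<^sub>m n m"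
  using assms by auto

lemma uminus_mult_dim:
  fixes A :: "'a::ring mat"
  assumes "dim_col A = dim_row B"
  shows "(- A) * B = - (A * B)" "A * (- B) = - (A * B)"
  using assms by auto

text \<open>Products are normalised to nest to the left, so an equation for \<open>B * C\<close> has
  no instance inside \<open>A * B * C\<close>. This form makes it applicable behind a prefix
  \<open>A\<close>.\<close>

lemma mult_left_eq:
  fixes A :: "'a::semiring_0 mat"
  assumes "B * C = R" "dim_col A = dim_row B" "dim_col B = dim_row C"
  shows "A * B * C = A * R"
  using assms mult_assoc_dim by metis

lemmas mat_ring = mult_assoc_dim add_mult_dim mult_add_dim minus_mult_dim mult_minus_dim
  smult_mult_dim mult_zero_dim mult_one_dim add_zero_dim

lemma smult_smult_mult:
  fixes A :: "'a::comm_ring_1 mat"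
  shows "c \<cdot>\<^sub>m (d \<cdot>\<^sub>m A) = (c * d) \<cdot>\<^sub>m A"
  by (rule eq_matI) (simp_all add: mult.assoc)

lemma smult_one_zero:
  fixes A :: "'a::comm_ring_1 mat"
  shows "1 \<cdot>\<^sub>m A = A" and "c \<cdot>\<^sub>m 0\<^sub>m n m = (0\<^sub>m n m :: 'a mat)"
  by auto

section \<open>Injections and projections of a two-block direct sum\<close>

definition inl_mat :: "nat \<Rightarrow> nat \<Rightarrow> complex mat" where
  "inl_mat n m = mat (n + m) n (\<lambda>(i, j). if i = j then 1 else 0)"

definition inr_mat :: "nat \<Rightarrow> nat \<Rightarrow> complex mat" where
  "inr_mat n m = mat (n + m) m (\<lambda>(i, j). if i = n + j then 1 else 0)"

definition fst_mat :: "nat \<Rightarrow> nat \<Rightarrow> complex mat" where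
  "fst_mat n m = mat n (n + m) (\<lambda>(i, j). if i = j then 1 else 0)"

definition snd_mat :: "nat \<Rightarrow> nat \<Rightarrow> complex mat" where
  "snd_mat n m = mat m (n + m) (\<lambda>(i, j). if n + i = j then 1 else 0)"

lemma dim_inj_proj [simp]:
  "dim_row (inl_mat n m) = n + m" "dim_col (inl_mat n m) = n"
  "dim_row (inr_mat n m) = n + m" "dim_col (inr_mat n m) = m"
  "dim_row (fst_mat n m) = n" "dim_col (fst_mat n m) = n + m"
  "dim_row (snd_mat n m) = m" "dim_col (snd_mat n m) = n + m"
  by (simp_all add: inl_mat_def inr_mat_def fst_mat_def snd_mat_def)

text \<open>Multiplying by these four matrices cuts out or inserts a block, so that block
  computations become ring identities. The entrywise formulas here and below serve the places where
  entries are compared.\<close>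

lemma mult_inl_mat:
  "dim_col M = n + m \<Longrightarrow> M * inl_mat n m = mat (dim_row M) n (\<lambda>(i, j). M $$ (i, j))"
  by (rule eq_matI) (auto simp: inl_mat_def scalar_prod_def if_distrib cong: if_cong)

lemma mult_inr_mat:
  "dim_col M = n + m \<Longrightarrow> M * inr_mat n m = mat (dim_row M) m (\<lambda>(i, j). M $$ (i, n + j))"
  by (rule eq_matI) (auto simp: inr_mat_def scalar_prod_def if_distrib cong: if_cong)

lemma fst_mat_mult:
  "dim_row M = n + m \<Longrightarrow> fst_mat n m * M = mat n (dim_col M) (\<lambda>(i, j). M $$ (i, j))"
  by (rule eq_matI) (auto simp: fst_mat_def scalar_prod_def if_distrib[of "\<lambda>x. x * _"] cong: if_cong)

lemma snd_mat_mult: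
  "dim_row M = n + m \<Longrightarrow> snd_mat n m * M = mat m (dim_col M) (\<lambda>(i, j). M $$ (n + i, j))"
  by (rule eq_matI) (auto simp: snd_mat_def scalar_prod_def if_distrib[of "\<lambda>x. x * _"] cong: if_cong)

lemma proj_inj_mat [simp]:
  "fst_mat n m * inl_mat n m = 1\<^sub>m n" "fst_mat n m * inr_mat n m = 0\<^sub>m n m"
  "snd_mat n m * inl_mat n m = 0\<^sub>m m n" "snd_mat n m * inr_mat n m = 1\<^sub>m m"
  by (rule eq_matI; simp add: mult_inl_mat mult_inr_mat; simp add: fst_mat_def snd_mat_def)+

lemma inl_mat_mult:
  "dim_row M = n \<Longrightarrow>
    inl_mat n m * M = mat (n + m) (dim_col M) (\<lambda>(i, j). if i < n then M $$ (i, j) else 0)"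
  by (rule eq_matI) (auto simp: inl_mat_def scalar_prod_def if_distrib[of "\<lambda>x. x * _"] cong: if_cong)

lemma inr_mat_mult:
  assumes "dim_row M = m"
  shows "inr_mat n m * M = mat (n + m) (dim_col M) (\<lambda>(i, j). if n \<le> i then M $$ (i - n, j) else 0)"
proof (rule eq_matI, goal_cases)
  case (1 i j)
  then have "(inr_mat n m * M) $$ (i, j) = (\<Sum>k<m. if i = n + k then M $$ (k, j) else 0)"
    using assms by (auto simp: inr_mat_def scalar_prod_def atLeast0LessThan intro!: sum.cong)
  \<comment> \<open>Solving \<open>i = n + k\<close> for \<open>k\<close> lets the sum collapse to
    one term; the guard \<open>n \<le> i\<close> excludes the rows where truncated subtraction
    returns 0 although no solution exists.\<close>
  also have "\<dots> = (\<Sum>k<m. if k = i - n then (if n \<le> i then M $$ (k, j) else 0) else 0)"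
    by (intro sum.cong) auto
  finally show ?case using 1 by auto
qed (use assms in auto)

lemma mult_fst_mat:
  "dim_col M = n \<Longrightarrow>
    M * fst_mat n m = mat (dim_row M) (n + m) (\<lambda>(i, j). if j < n then M $$ (i, j) else 0)"
  by (rule eq_matI) (auto simp: fst_mat_def scalar_prod_def if_distrib cong: if_cong)

lemma mult_snd_mat:
  assumes "dim_col M = m"
  shows "M * snd_mat n m = mat (dim_row M) (n + m) (\<lambda>(i, j). if n \<le> j then M $$ (i, j - n) else 0)"
proof (rule eq_matI, goal_cases)
  case (1 i j)
  then have "(M * snd_mat n m) $$ (i, j) = (\<Sum>k<m. if n + k = j then M $$ (i, k) else 0)"
    using assms by (auto simp: snd_mat_def scalar_prod_def atLeast0LessThan intro!: sum.cong)
  also have "\<dots> = (\<Sum>k<m. if k = j - n then (if n \<le> j then M $$ (i, k) else 0) else 0)"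
    by (intro sum.cong) auto
  finally show ?case using 1 by auto
qed (use assms in auto)

lemmas inj_proj_mult = mult_inl_mat mult_inr_mat fst_mat_mult snd_mat_mult
  inl_mat_mult inr_mat_mult mult_fst_mat mult_snd_mat

lemma inj_proj_sum: "inl_mat n m * fst_mat n m + inr_mat n m * snd_mat n m = 1\<^sub>m (n + m)"
  by (rule eq_matI; simp add: inj_proj_mult del: index_mult_mat(1)) (auto simp: inl_mat_def inr_mat_def)

lemma index_corner:
  assumes "dim_row B = n" "dim_col B = m" "a < n + m" "b < n + m"
  shows "(inl_mat n m * B * snd_mat n m) $$ (a, b) = (if a < n \<and> n \<le> b then B $$ (a, b - n) else 0)"
  using assms by (simp add: inl_mat_mult mult_snd_mat del: index_mult_mat(1))

section \<open>Block upper triangular matrices\<close>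

definition upper_mat :: "complex mat \<Rightarrow> complex mat \<Rightarrow> complex mat \<Rightarrow> complex mat" where
  "upper_mat A B D = four_block_mat A B (0\<^sub>m (dim_row D) (dim_col A)) D"

lemma dim_upper_mat [simp]:
  "dim_row (upper_mat A B D) = dim_row A + dim_row D"
  "dim_col (upper_mat A B D) = dim_col A + dim_col D"
  by (simp_all add: upper_mat_def)

lemma upper_mat_carrier [simp]:
  "A \<in> carrier_mat n n \<Longrightarrow> D \<in> carrier_mat m m \<Longrightarrow> upper_mat A B D \<in> carrier_mat (n + m) (n + m)"
  by (simp add: upper_mat_def)

lemma upper_mat_mult:
  assumes "A \<in> carrier_mat n n" "B \<in> carrier_mat n m" "D \<in> carrier_mat m m"
    and "A' \<in> carrier_mat n n" "B' \<in> carrier_mat n m" "D' \<in> carrier_mat m m"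
  shows "upper_mat A B D * upper_mat A' B' D' = upper_mat (A * A') (A * B' + B * D') (D * D')"
  unfolding upper_mat_def using assms by (subst mult_four_block_mat) auto

lemma upper_mat_inj_proj:
  assumes "A \<in> carrier_mat n n" "B \<in> carrier_mat n m" "D \<in> carrier_mat m m"
  shows "upper_mat A B D * inl_mat n m = inl_mat n m * A"
    and "upper_mat A B D * inr_mat n m = inl_mat n m * B + inr_mat n m * D"
    and "fst_mat n m * upper_mat A B D = A * fst_mat n m + B * snd_mat n m"
    and "snd_mat n m * upper_mat A B D = D * snd_mat n m"
    and "fst_mat n m * upper_mat A B D * inr_mat n m = B"
    and "fst_mat n m * upper_mat A B D * inl_mat n m = A"
  using assms by (auto simp: inj_proj_mult upper_mat_def simp del: index_mult_mat(1) intro!: eq_matI)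

lemma upper_mat_expand:
  assumes "A \<in> carrier_mat n n" "B \<in> carrier_mat n m" "D \<in> carrier_mat m m"
  shows "upper_mat A B D =
    inl_mat n m * A * fst_mat n m + inl_mat n m * B * snd_mat n m + inr_mat n m * D * snd_mat n m"
  using assms by (auto simp: inj_proj_mult upper_mat_def simp del: index_mult_mat(1) intro!: eq_matI)

subsection \<open>Free maps respect intertwiners\<close>

lemma mtuplesD:
  assumes "X \<in> mtuples n"
  shows "X i \<in> carrier_mat n n" "dim_row (X i) = n" "dim_col (X i) = n"
  using assms by (auto simp: mtuples_def dest: spec[of _ i])

lemma mtuplesI: "(\<And>i. dim_row (X i) = n) \<Longrightarrow> (\<And>i. dim_col (X i) = n) \<Longrightarrow> X \<in> mtuples n"
  by (auto simp: mtuples_def intro: carrier_matI)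

definition tuple_upper :: "'g mtuple \<Rightarrow> 'g mtuple \<Rightarrow> 'g mtuple \<Rightarrow> 'g mtuple" where
  "tuple_upper X B Y = (\<lambda>i. upper_mat (X i) (B i) (Y i))"

lemma tuple_upper_mtuples:
  "X \<in> mtuples n \<Longrightarrow> Y \<in> mtuples m \<Longrightarrow> tuple_upper X B Y \<in> mtuples (n + m)"
  by (simp add: mtuples_def tuple_upper_def)

lemma tuple_dsum_upper:
  assumes "X \<in> mtuples n" "Y \<in> mtuples m"
  shows "tuple_dsum X Y = tuple_upper X (\<lambda>_. 0\<^sub>m n m) Y"
  by (simp add: tuple_dsum_def tuple_upper_def upper_mat_def mtuplesD[OF assms(1)] mtuplesD[OF assms(2)])

lemma tuple_dsum_inj_proj:
  assumes "X \<in> mtuples n" "Y \<in> mtuples m"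
  shows "tuple_dsum X Y i * inl_mat n m = inl_mat n m * X i"
    and "tuple_dsum X Y i * inr_mat n m = inr_mat n m * Y i"
    and "fst_mat n m * tuple_dsum X Y i = X i * fst_mat n m"
    and "snd_mat n m * tuple_dsum X Y i = Y i * snd_mat n m"
  unfolding tuple_dsum_upper[OF assms] tuple_upper_def
  using mtuplesD[OF assms(1)] mtuplesD[OF assms(2)]
  by (subst upper_mat_inj_proj; auto simp: mult_zero_dim)+

lemma uminus_mult_eqD:
  fixes A :: "'a::comm_ring_1 mat"
  assumes "A \<in> carrier_mat n m" "W \<in> carrier_mat n k" "B \<in> carrier_mat k m" "A + (- W) * B = 0\<^sub>m n m"
  shows "A = W * B"
proof (rule eq_matI, goal_cases)
  case (1 i j)
  then have "(A + - (W * B)) $$ (i, j) = 0" using assms by (simp add: uminus_mult_left_mat)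
  then show ?case using 1 assms(1-3) by (simp del: index_mult_mat(1))
qed (use assms in auto)

lemma mult_uminus_cancel:
  fixes A :: "'a::comm_ring_1 mat"
  assumes "A \<in> carrier_mat n m" "W \<in> carrier_mat n k" "B \<in> carrier_mat k m" "A = W * B"
  shows "A + (- W) * B = 0\<^sub>m n m"
  using assms by (intro eq_matI) (auto simp: uminus_mult_left_mat simp del: index_mult_mat(1))

lemma upper_one_GL_pairs:
  assumes "W \<in> carrier_mat n m"
  shows "(upper_mat (1\<^sub>m n) W (1\<^sub>m m), upper_mat (1\<^sub>m n) (- W) (1\<^sub>m m)) \<in> GL_pairs (n + m)"
proof -
  have "upper_mat (1\<^sub>m n) W (1\<^sub>m m) * upper_mat (1\<^sub>m n) (- W) (1\<^sub>m m) = 1\<^sub>m (n + m)"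
    "upper_mat (1\<^sub>m n) (- W) (1\<^sub>m m) * upper_mat (1\<^sub>m n) W (1\<^sub>m m) = 1\<^sub>m (n + m)"
    by (subst upper_mat_mult[of _ n _ m]; use assms in \<open>auto simp: upper_mat_def intro!: eq_matI\<close>)+
  then show ?thesis by (simp add: GL_pairs_def inverts_mat_def)
qed

text \<open>The corner \<open>X W - W Y\<close> measures how far \<open>W\<close> is from
  intertwining \<open>X\<close> and \<open>Y\<close>. The sign sits inside the factor
  \<open>- W\<close> because the block product produces it there.\<close>

lemma conj_upper_one:
  assumes "X \<in> mtuples n" "Y \<in> mtuples m" "W \<in> carrier_mat n m"
  shows "tuple_conj (upper_mat (1\<^sub>m n) W (1\<^sub>m m), upper_mat (1\<^sub>m n) (- W) (1\<^sub>m m)) (tuple_dsum X Y) =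
    tuple_upper X (\<lambda>i. X i * W + (- W) * Y i) Y"
proof
  fix i
  note [simp] = mtuplesD[OF assms(1)] mtuplesD[OF assms(2)]
  have "- W * Y i \<in> carrier_mat n m" using assms(3) by auto
  then show "tuple_conj (upper_mat (1\<^sub>m n) W (1\<^sub>m m), upper_mat (1\<^sub>m n) (- W) (1\<^sub>m m)) (tuple_dsum X Y) i =
    tuple_upper X (\<lambda>i. X i * W + (- W) * Y i) Y i"
    using assms by (simp add: tuple_conj_def tuple_dsum_upper tuple_upper_def upper_mat_mult[of _ n _ m])
qed

lemma free_setD:
  assumes "free_set \<Omega>"
  shows "n > 0 \<Longrightarrow> X \<in> \<Omega> n \<Longrightarrow> X \<in> mtuples n"
    and "n > 0 \<Longrightarrow> m > 0 \<Longrightarrow> X \<in> \<Omega> n \<Longrightarrow> Y \<in> \<Omega> m \<Longrightarrow> tuple_dsum X Y \<in> \<Omega> (n + m)"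
    and "n > 0 \<Longrightarrow> X \<in> \<Omega> n \<Longrightarrow> P \<in> GL_pairs n \<Longrightarrow> tuple_conj P X \<in> \<Omega> n"
  using assms by (auto simp: free_set_def)

lemma free_mapD:
  assumes "free_map \<Omega> F"
  shows "n > 0 \<Longrightarrow> X \<in> \<Omega> n \<Longrightarrow> F n X \<in> mtuples n"
    and "n > 0 \<Longrightarrow> m > 0 \<Longrightarrow> X \<in> \<Omega> n \<Longrightarrow> Y \<in> \<Omega> m \<Longrightarrow>
      F (n + m) (tuple_dsum X Y) = tuple_dsum (F n X) (F m Y)"
    and "n > 0 \<Longrightarrow> X \<in> \<Omega> n \<Longrightarrow> P \<in> GL_pairs n \<Longrightarrow> F n (tuple_conj P X) = tuple_conj P (F n X)"
  using assms by (auto simp: free_map_def)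

lemma tuple_upper_inject:
  assumes "tuple_upper X B Y = tuple_upper X B' Y" "X \<in> mtuples n" "Y \<in> mtuples m"
    and "\<And>i. B i \<in> carrier_mat n m" "\<And>i. B' i \<in> carrier_mat n m"
  shows "B i = B' i"
proof -
  have "upper_mat (X i) (B i) (Y i) = upper_mat (X i) (B' i) (Y i)"
    using assms(1) unfolding tuple_upper_def by metis
  then show ?thesis
    using upper_mat_inj_proj(5)[of "X i" n _ m "Y i"] assms(2-) by (metis mtuplesD(1))
qed

text \<open>If \<open>X W = W Y\<close>, then \<open>X \<oplus> Y\<close> commutes with the unipotent matrix whose upper right block
  is \<open>W\<close>.\<close>

lemma free_map_intertwine:
  assumes "free_set \<Omega>" "free_map \<Omega> F" "n > 0" "m > 0" "X \<in> \<Omega> n" "Y \<in> \<Omega> m"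
    and W: "W \<in> carrier_mat n m" and XW: "\<And>i. X i * W = W * Y i"
  shows "F n X j * W = W * F m Y j"
proof -
  have X: "X \<in> mtuples n" "Y \<in> mtuples m" using free_setD(1)[OF assms(1)] assms(3-6) by auto
  have FX: "F n X \<in> mtuples n" "F m Y \<in> mtuples m" using free_mapD(1)[OF assms(2)] assms(3-6) by auto
  let ?P = "(upper_mat (1\<^sub>m n) W (1\<^sub>m m), upper_mat (1\<^sub>m n) (- W) (1\<^sub>m m))"
  have "tuple_conj ?P (tuple_dsum X Y) = tuple_dsum X Y"
    unfolding conj_upper_one[OF X W] unfolding tuple_dsum_upper[OF X]
    using XW W mtuplesD[OF X(1)] mtuplesD[OF X(2)] by (intro arg_cong[of _ _ "\<lambda>B. tuple_upper X B Y"] ext mult_uminus_cancel) auto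
  \<comment> \<open>Freeness carries the conjugation and the direct sum through \<open>F\<close>, so
    the same unipotent matrix commutes with \<open>F X \<oplus> F Y\<close>.\<close>
  then have "tuple_conj ?P (tuple_dsum (F n X) (F m Y)) = tuple_dsum (F n X) (F m Y)"
    using free_mapD(2,3)[OF assms(2)] free_setD(2)[OF assms(1)] assms(3-6) upper_one_GL_pairs[OF W]
    by (metis add_gr_0)
  then have "tuple_upper (F n X) (\<lambda>i. F n X i * W + (- W) * F m Y i) (F m Y) =
      tuple_upper (F n X) (\<lambda>_. 0\<^sub>m n m) (F m Y)"
    unfolding conj_upper_one[OF FX W] unfolding tuple_dsum_upper[OF FX] .
  moreover have "F n X i * W + (- W) * F m Y i \<in> carrier_mat n m" for i
    by (rule add_carrier_mat, rule mult_carrier_mat[OF _ mtuplesD(1)[OF FX(2)]])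
      (simp add: W)
  ultimately have "F n X j * W + (- W) * F m Y j = 0\<^sub>m n m"
    by (rule tuple_upper_inject[OF _ FX _ zero_carrier_mat])
  then show ?thesis
    by (rule uminus_mult_eqD[OF mult_carrier_mat[OF mtuplesD(1)[OF FX(1)] W] W mtuplesD(1)[OF FX(2)]])
qed

section \<open>Pairs of points and directions as one tuple\<close>

lemma tuple_pair_mtuples: "tuple_pair X H \<in> mtuples n \<longleftrightarrow> X \<in> mtuples n \<and> H \<in> mtuples n"
  by (simp add: mtuples_def split: sum.splits) blast

lemma tuple_pair_ops:
  "tuple_dsum (tuple_pair X H) (tuple_pair Y K) = tuple_pair (tuple_dsum X Y) (tuple_dsum H K)"
  "tuple_conj P (tuple_pair X H) = tuple_pair (tuple_conj P X) (tuple_conj P H)"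
  "tuple_add (tuple_pair X H) (tuple_pair Y K) = tuple_pair (tuple_add X Y) (tuple_add H K)"
  "tuple_scale c (tuple_pair X H) = tuple_pair (tuple_scale c X) (tuple_scale c H)"
  "tuple_upper (tuple_pair X H) (tuple_pair A B) (tuple_pair Y K) =
    tuple_pair (tuple_upper X A Y) (tuple_upper H B K)"
  by (auto simp: tuple_dsum_def tuple_conj_def tuple_add_def tuple_scale_def tuple_upper_def
      split: sum.splits)

lemma tuple_pair_eq_iff: "tuple_pair X H = tuple_pair Y K \<longleftrightarrow> X = Y \<and> H = K"
  by (metis (no_types) case_sum_inject)

lemma mem_times_mtuples: "tuple_pair X H \<in> times_mtuples \<Omega> n \<longleftrightarrow> X \<in> \<Omega> n \<and> H \<in> mtuples n"
  by (auto simp: times_mtuples_def tuple_pair_eq_iff)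

lemma tuple_dsum_mtuples:
  "X \<in> mtuples n \<Longrightarrow> Y \<in> mtuples m \<Longrightarrow> tuple_dsum X Y \<in> mtuples (n + m)"
  by (simp add: tuple_dsum_upper tuple_upper_mtuples)

lemma tuple_conj_mtuples: "X \<in> mtuples n \<Longrightarrow> P \<in> GL_pairs n \<Longrightarrow> tuple_conj P X \<in> mtuples n"
  by (auto simp: mtuples_def tuple_conj_def GL_pairs_def intro!: mult_carrier_mat[where n = n])

text \<open>A free vector field is a free map on the product set; with this, intertwining and the
  corner formula for derivatives apply to \<open>T\<close> itself.\<close>

lemma free_set_times:
  assumes "free_set \<Omega>"
  shows "free_set (times_mtuples \<Omega>)"
  unfolding free_set_def
proof (intro conjI allI impI ballI subsetI, goal_cases)
  case (1 n X)
  then show ?case by (auto simp: times_mtuples_def tuple_pair_mtuples dest: free_setD(1)[OF assms])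
next
  case (2 n m X Y)
  then obtain A H B K where "X = tuple_pair A H" "Y = tuple_pair B K" "A \<in> \<Omega> n" "B \<in> \<Omega> m"
    "H \<in> mtuples n" "K \<in> mtuples m" by (auto simp: times_mtuples_def)
  with 2 show ?case
    by (simp add: tuple_pair_ops mem_times_mtuples free_setD[OF assms] tuple_dsum_mtuples)
next
  case (3 n X P)
  then obtain A H where "X = tuple_pair A H" "A \<in> \<Omega> n" "H \<in> mtuples n"
    by (auto simp: times_mtuples_def)
  with 3 show ?case
    by (simp add: tuple_pair_ops mem_times_mtuples free_setD[OF assms] tuple_conj_mtuples)
qed

text \<open>Block computations nest products to the left through \<open>mult_assoc_dim\<close>; a
  simplification rule in the opposite direction would loop with it.\<close>

declare assoc_mult_mat [simp del]

lemma tuple_ops_mtuples [simp]: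
  "H \<in> mtuples n \<Longrightarrow> K \<in> mtuples n \<Longrightarrow> tuple_add H K \<in> mtuples n"
  "H \<in> mtuples n \<Longrightarrow> K \<in> mtuples n \<Longrightarrow> tuple_diff H K \<in> mtuples n"
  "H \<in> mtuples n \<Longrightarrow> tuple_scale c H \<in> mtuples n"
  "tuple_zero n \<in> mtuples n"
  by (auto simp: mtuples_def tuple_add_def tuple_diff_def tuple_scale_def tuple_zero_def
      intro!: minus_carrier_mat)

subsection \<open>The free curl as a derivation\<close>

locale free_vf =
  fixes \<Omega> :: "nat \<Rightarrow> 'g::finite mtuple set"
    and T :: "nat \<Rightarrow> ('g + 'g) mtuple \<Rightarrow> 'h::finite mtuple"
  assumes free: "free_set \<Omega>" and vf: "free_vector_field \<Omega> T"
begin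

lemma free_T: "free_map (times_mtuples \<Omega>) T"
  using vf by (simp add: free_vector_field_def)

lemma T_mtuples: "n > 0 \<Longrightarrow> X \<in> \<Omega> n \<Longrightarrow> H \<in> mtuples n \<Longrightarrow> T n (tuple_pair X H) \<in> mtuples n"
  by (rule free_mapD(1)[OF free_T]) (simp_all add: mem_times_mtuples)

lemma T_linear:
  "n > 0 \<Longrightarrow> X \<in> \<Omega> n \<Longrightarrow> H \<in> mtuples n \<Longrightarrow> K \<in> mtuples n \<Longrightarrow>
    T n (tuple_pair X (tuple_add (tuple_scale c H) K)) j =
      c \<cdot>\<^sub>m T n (tuple_pair X H) j + T n (tuple_pair X K) j"
  using vf by (simp add: free_vector_field_def tuple_add_def tuple_scale_def)

lemma T_add:
  assumes "n > 0" "X \<in> \<Omega> n" "H \<in> mtuples n" "K \<in> mtuples n"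
  shows "T n (tuple_pair X (tuple_add H K)) j = T n (tuple_pair X H) j + T n (tuple_pair X K) j"
proof -
  have "tuple_scale 1 H = H" by (simp add: tuple_scale_def smult_one_zero)
  then show ?thesis using T_linear[OF assms, of 1 j] by (simp add: smult_one_zero)
qed

lemma T_zero:
  assumes "n > 0" "X \<in> \<Omega> n"
  shows "T n (tuple_pair X (tuple_zero n)) j = 0\<^sub>m n n"
proof -
  \<comment> \<open>With \<open>c = -1\<close> and both directions zero, linearity expresses the
    value at the zero direction as the difference of that value with itself.\<close>
  have "tuple_add (tuple_scale (-1) (tuple_zero n)) (tuple_zero n) = (tuple_zero n :: 'g mtuple)"
    by (auto simp: tuple_zero_def tuple_add_def tuple_scale_def)
  then have "T n (tuple_pair X (tuple_zero n)) j =
      (-1) \<cdot>\<^sub>m T n (tuple_pair X (tuple_zero n)) j + T n (tuple_pair X (tuple_zero n)) j"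
    using T_linear[OF assms tuple_ops_mtuples(4) tuple_ops_mtuples(4), of "-1" j] by simp
  also have "\<dots> = 0\<^sub>m n n"
    using mtuplesD[OF T_mtuples[OF assms tuple_ops_mtuples(4)], of j] by (intro eq_matI) auto
  finally show ?thesis .
qed

text \<open>In the product set a morphism between \<open>(X, H)\<close> and \<open>(Y, K)\<close>
  has to intertwine base points and directions with the same \<open>W\<close>.\<close>

lemma T_intertwine:
  assumes "n > 0" "m > 0" "X \<in> \<Omega> n" "Y \<in> \<Omega> m" "H \<in> mtuples n" "K \<in> mtuples m"
    and "W \<in> carrier_mat n m" "\<And>i. X i * W = W * Y i" "\<And>i. H i * W = W * K i"
  shows "T n (tuple_pair X H) j * W = W * T m (tuple_pair Y K) j"
  by (rule free_map_intertwine[OF free_set_times[OF free] free_T])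
    (use assms in \<open>simp_all add: mem_times_mtuples split: sum.split\<close>)

text \<open>Here \<open>W\<close> intertwines \<open>(X, H)\<close> with \<open>Y\<close> in the
  zero direction, where \<open>T\<close> vanishes by linearity.\<close>

lemma T_kernel:
  assumes "n > 0" "m > 0" "X \<in> \<Omega> n" "Y \<in> \<Omega> m" "H \<in> mtuples n"
    and "W \<in> carrier_mat n m" "\<And>i. X i * W = W * Y i" "\<And>i. H i * W = 0\<^sub>m n m"
  shows "T n (tuple_pair X H) j * W = 0\<^sub>m n m"
proof -
  have "T n (tuple_pair X H) j * W = W * T m (tuple_pair Y (tuple_zero m)) j"
    using assms by (intro T_intertwine) (simp_all, simp add: tuple_zero_def)
  then show ?thesis using assms(6) by (simp add: T_zero[OF assms(2,4)])
qed

text \<open>The two-point form of \<open>T\<close>. If \<open>T\<close> is the derivative of a free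
  map \<open>f\<close>, this is the noncommutative difference quotient: the upper right block of
  \<open>f\<close> at the matrix with rows \<open>X, B\<close> and \<open>0, Y\<close>, where that
  point lies in the domain.\<close>

definition diff_block :: "nat \<Rightarrow> nat \<Rightarrow> 'g mtuple \<Rightarrow> 'g mtuple \<Rightarrow> 'g mtuple \<Rightarrow> 'h mtuple" where
  "diff_block n m X Y B =
    (\<lambda>j. fst_mat n m * T (n + m) (tuple_pair (tuple_dsum X Y)
      (\<lambda>i. inl_mat n m * B i * snd_mat n m)) j * inr_mat n m)"

lemma corner_mtuples: "(\<lambda>i. inl_mat n m * B i * snd_mat n m) \<in> mtuples (n + m)"
  by (auto simp: mtuples_def)

lemma diff_block_carrier [simp]:
  "diff_block n m X Y B j \<in> carrier_mat n m"
  "dim_row (diff_block n m X Y B j) = n" "dim_col (diff_block n m X Y B j) = m"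
  unfolding diff_block_def by (auto intro!: carrier_matI)

text \<open>The row \<open>W = (I1, I2)\<close> intertwines \<open>(P, G)\<close> with
  \<open>X \<oplus> Y\<close> in the corner direction \<open>B\<close>; the claim is the second
  column of the resulting identity. This reduces values of \<open>T\<close> on larger block matrices
  to \<open>diff_block\<close>.\<close>

lemma diff_block_intertwine:
  assumes "n > 0" "m > 0" "N > 0" "X \<in> \<Omega> n" "Y \<in> \<Omega> m" "P \<in> \<Omega> N" "G \<in> mtuples N"
    and B: "\<And>i. B i \<in> carrier_mat n m"
    and I: "I1 \<in> carrier_mat N n" "I2 \<in> carrier_mat N m"
    and PI: "\<And>i. P i * I1 = I1 * X i" "\<And>i. P i * I2 = I2 * Y i"
    and GI: "\<And>i. G i * I1 = 0\<^sub>m N n" "\<And>i. G i * I2 = I1 * B i"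
  shows "T N (tuple_pair P G) j * I2 = I1 * diff_block n m X Y B j"
proof -
  define E where "E = (\<lambda>i. inl_mat n m * B i * snd_mat n m)"
  define Q where "Q = T (n + m) (tuple_pair (tuple_dsum X Y) E) j"
  define W where "W = I1 * fst_mat n m + I2 * snd_mat n m"
  note mt = free_setD(1)[OF free \<open>n > 0\<close> \<open>X \<in> \<Omega> n\<close>] free_setD(1)[OF free \<open>m > 0\<close> \<open>Y \<in> \<Omega> m\<close>]
    free_setD(1)[OF free \<open>N > 0\<close> \<open>P \<in> \<Omega> N\<close>]
  note dim [simp] = carrier_matD[OF I(1)] carrier_matD[OF I(2)] carrier_matD[OF B]
    mtuplesD[OF mt(1)] mtuplesD[OF mt(2)] mtuplesD[OF mt(3)] mtuplesD[OF \<open>G \<in> mtuples N\<close>]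
  have E: "E \<in> mtuples (n + m)" unfolding E_def by (rule corner_mtuples)
  have XY: "tuple_dsum X Y \<in> \<Omega> (n + m)" using assms free_setD(2)[OF free] by blast
  note mtXY = tuple_dsum_mtuples[OF mt(1,2)]
  have Q: "Q \<in> carrier_mat (n + m) (n + m)"
    unfolding Q_def by (rule mtuplesD(1)[OF T_mtuples[OF _ XY E]]) (use \<open>n > 0\<close> in simp)
  note dimQ [simp] = carrier_matD[OF Q] mtuplesD[OF mtXY]
  note eqs = tuple_dsum_inj_proj[OF mt(1,2)]
  have W [simp]: "W \<in> carrier_mat N (n + m)" by (intro carrier_matI) (simp_all add: W_def)
  have "T N (tuple_pair P G) j * W = W * Q"
    unfolding Q_def
  proof (rule T_intertwine)
    show "P i * W = W * tuple_dsum X Y i" for i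
      by (simp add: W_def mat_ring PI mult_left_eq[OF eqs(3)] mult_left_eq[OF eqs(4)])
    show "G i * W = W * E i" for i
      by (simp add: W_def E_def mat_ring GI mult_left_eq[OF proj_inj_mat(1)] mult_left_eq[OF proj_inj_mat(3)])
  qed (use assms(1-7) E XY in auto)
  then have "T N (tuple_pair P G) j * (W * inr_mat n m) = W * Q * inr_mat n m"
    using mtuplesD[OF T_mtuples[OF \<open>N > 0\<close> \<open>P \<in> \<Omega> N\<close> \<open>G \<in> mtuples N\<close>], of j] by (simp add: mat_ring carrier_matD[OF W])
  moreover have "W * inr_mat n m = I2"
    by (simp add: W_def mat_ring mult_left_eq[OF proj_inj_mat(2)] mult_left_eq[OF proj_inj_mat(4)])
  \<comment> \<open>The projection onto the second summand intertwines the corner direction with the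
    zero direction at \<open>Y\<close>. Hence the lower block row of \<open>Q\<close> vanishes and
    \<open>I2\<close> drops out of \<open>W * Q\<close>.\<close>
  moreover have sQ: "snd_mat n m * Q = 0\<^sub>m m (n + m)"
  proof -
    have "T m (tuple_pair Y (tuple_zero m)) j * snd_mat n m = snd_mat n m * Q"
      unfolding Q_def
    proof (rule T_intertwine)
      show "tuple_zero m i * snd_mat n m = snd_mat n m * E i" for i
        by (simp add: tuple_zero_def E_def mat_ring)
    qed (use assms(1,2,5) E XY in \<open>auto simp: eqs intro!: carrier_matI\<close>)
    then show ?thesis using assms(2,5) by (simp add: T_zero mat_ring)
  qed
  moreover have "W * Q * inr_mat n m = I1 * (fst_mat n m * Q * inr_mat n m)"
    by (simp add: W_def mat_ring mult_left_eq[OF sQ])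
  ultimately show ?thesis by (simp add: diff_block_def E_def Q_def)
qed

lemma diff_block_linear:
  assumes "n > 0" "m > 0" "X \<in> \<Omega> n" "Y \<in> \<Omega> m"
    and "\<And>i. B i \<in> carrier_mat n m" "\<And>i. C i \<in> carrier_mat n m"
  shows "diff_block n m X Y (\<lambda>i. c \<cdot>\<^sub>m B i + C i) j = c \<cdot>\<^sub>m diff_block n m X Y B j + diff_block n m X Y C j"
proof -
  have XY: "tuple_dsum X Y \<in> \<Omega> (n + m)" using assms free_setD(2)[OF free] by blast
  have [simp]: "dim_row (B i) = n" "dim_col (B i) = m" "dim_row (C i) = n" "dim_col (C i) = m" for i
    using assms(5,6)[of i] by auto
  have "(\<lambda>i. inl_mat n m * (c \<cdot>\<^sub>m B i + C i) * snd_mat n m) =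
    tuple_add (tuple_scale c (\<lambda>i. inl_mat n m * B i * snd_mat n m)) (\<lambda>i. inl_mat n m * C i * snd_mat n m)"
    by (simp add: tuple_add_def tuple_scale_def mat_ring fun_eq_iff)
  then show ?thesis
    using mtuplesD(2,3)[OF T_mtuples[OF _ XY corner_mtuples]] \<open>n > 0\<close>
    by (simp add: diff_block_def T_linear[OF _ XY corner_mtuples corner_mtuples] mat_ring)
qed

text \<open>\<open>E\<^sub>1\<^sub>1 + E\<^sub>1\<^sub>2\<close> maps the second basis vector to the first and kills the difference of the two, so
  linearity of \<open>T\<close> moves the diagonal value to the corner.\<close>

lemma diff_block_diag:
  assumes "n > 0" "X \<in> \<Omega> n" "H \<in> mtuples n"
  shows "diff_block n n X X H j = T n (tuple_pair X H) j"
proof -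
  define P where "P = tuple_dsum X X"
  define G where "G = (\<lambda>i. inl_mat n n * H i * snd_mat n n)"
  define G' where "G' = (\<lambda>i. inl_mat n n * H i * fst_mat n n)"
  have X: "X \<in> mtuples n" using free_setD(1)[OF free] assms by blast
  have P: "P \<in> \<Omega> (n + n)" using assms free_setD(2)[OF free] by (auto simp: P_def)
  have [simp]: "G \<in> mtuples (n + n)" "G' \<in> mtuples (n + n)" by (auto simp: mtuples_def G_def G'_def)
  note [simp] = mtuplesD[OF X] mtuplesD[OF assms(3)] mtuplesD[OF free_setD(1)[OF free _ P]]
    mtuplesD[OF T_mtuples[OF _ P]] mtuplesD[OF T_mtuples[OF assms(1,2)]]
  note eqs = tuple_dsum_inj_proj[OF X X, folded P_def]
  note pij = mult_left_eq[OF proj_inj_mat(1)] mult_left_eq[OF proj_inj_mat(2)]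
    mult_left_eq[OF proj_inj_mat(3)] mult_left_eq[OF proj_inj_mat(4)]
  note GG = tuple_add_def G_def G'_def
  let ?T = "\<lambda>G. T (n + n) (tuple_pair P G) j"
  have 1: "?T (tuple_add G G') * inl_mat n n = inl_mat n n * T n (tuple_pair X H) j"
    by (rule T_intertwine) (use assms P in \<open>auto simp: eqs GG mat_ring pij intro!: carrier_matI mtuplesI\<close>)
  have 2: "?T (tuple_add G G') * (inr_mat n n - inl_mat n n) = 0\<^sub>m (n + n) n"
    by (rule T_kernel[where Y = X]) (use assms P in \<open>auto simp: eqs GG mat_ring pij intro!: carrier_matI mtuplesI\<close>)
  have 3: "?T G' * inr_mat n n = 0\<^sub>m (n + n) n"
    by (rule T_kernel[where Y = X]) (use assms P in \<open>auto simp: eqs GG mat_ring pij intro!: carrier_matI mtuplesI\<close>)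
  have 4: "?T (tuple_add G G') = ?T G + ?T G'"
    by (rule T_add) (use assms P in auto)
  \<comment> \<open>By \<open>2\<close> the two block columns of the value at \<open>G + G'\<close>
    agree, and by \<open>3\<close> the part \<open>G'\<close> contributes nothing to the second
    one.\<close>
  have "?T G * inr_mat n n = inl_mat n n * T n (tuple_pair X H) j"
  proof (rule eq_matI, goal_cases)
    case (1 r c)
    then have "(?T (tuple_add G G') * (inr_mat n n - inl_mat n n)) $$ (r, c) = 0"
      using 2 assms by simp
    moreover have "(?T G' * inr_mat n n) $$ (r, c) = 0" using 3 1 assms by simp
    ultimately show ?case using 1 assms \<open>?T (tuple_add G G') * inl_mat n n = _\<close> 4
      by (simp add: mult_minus_dim add_mult_dim del: index_mult_mat(1))
  qed (use assms in auto)
  then have "fst_mat n n * ?T G * inr_mat n n = fst_mat n n * (inl_mat n n * T n (tuple_pair X H) j)"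
    using assms(1) by (simp flip: mult_assoc_dim)
  also have "\<dots> = T n (tuple_pair X H) j" using assms by (simp add: mat_ring)
  finally show ?thesis by (simp only: diff_block_def P_def G_def)
qed

text \<open>The injections \<open>I\<close> and projections \<open>J\<close> present \<open>P\<close> as \<open>X \<oplus> Y \<oplus> Z\<close>. The two parts compute the
  \<open>(1,3)\<close> block of \<open>DT(P,H)[K,0]\<close> and of \<open>DT(P,K)[H,0]\<close>.\<close>

lemma diff_block_derivation_aux:
  assumes pos: "n > 0" "m > 0" "l > 0" "N > 0" and mem: "X \<in> \<Omega> n" "Y \<in> \<Omega> m" "Z \<in> \<Omega> l" "P \<in> \<Omega> N"
    and I [simp]: "dim_row I1 = N" "dim_col I1 = n" "dim_row I2 = N" "dim_col I2 = m" "dim_row I3 = N" "dim_col I3 = l"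
    and J [simp]: "dim_row J1 = n" "dim_col J1 = N" "dim_row J2 = m" "dim_col J2 = N" "dim_row J3 = l" "dim_col J3 = N"
    and PI: "\<And>i. P i * I1 = I1 * X i" "\<And>i. P i * I2 = I2 * Y i" "\<And>i. P i * I3 = I3 * Z i"
    and JI: "J1 * I1 = 1\<^sub>m n" "J1 * I2 = 0\<^sub>m n m" "J1 * I3 = 0\<^sub>m n l"
      "J2 * I1 = 0\<^sub>m m n" "J2 * I2 = 1\<^sub>m m" "J2 * I3 = 0\<^sub>m m l"
      "J3 * I1 = 0\<^sub>m l n" "J3 * I2 = 0\<^sub>m l m" "J3 * I3 = 1\<^sub>m l"
    and UV [simp]: "dim_row U = n" "dim_col U = m" "dim_row V = m" "dim_col V = l"
    and A: "A = (\<lambda>i. X i * U - U * Y i)" and B: "B = (\<lambda>i. Y i * V - V * Z i)"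
    and K: "K = (\<lambda>i. I1 * A i * J2)" and H: "H = (\<lambda>i. I2 * B i * J3)"
    and up: "tuple_upper P K P \<in> \<Omega> (N + N)"
  shows "J1 * (fst_mat N N * T (N + N) (tuple_pair (tuple_upper P K P) (tuple_dsum H H)) j * inr_mat N N) * I3 =
    diff_block n l X Z (\<lambda>i. U * B i) j - U * diff_block m l Y Z B j"
    and "tuple_upper P H P \<in> \<Omega> (N + N) \<Longrightarrow>
      J1 * (fst_mat N N * T (N + N) (tuple_pair (tuple_upper P H P) (tuple_dsum K K)) j * inr_mat N N) * I3 =
    diff_block n l X Z (\<lambda>i. - (A i * V)) j + diff_block n m X Y A j * V"
proof -
  define a b p q where abpq: "a = inl_mat N N" "b = inr_mat N N" "p = fst_mat N N" "q = snd_mat N N"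
  note mt = free_setD(1)[OF free pos(1) mem(1)] free_setD(1)[OF free pos(2) mem(2)]
    free_setD(1)[OF free pos(3) mem(3)] free_setD(1)[OF free pos(4) mem(4)]
  have [simp]: "dim_row a = N + N" "dim_col a = N" "dim_row b = N + N" "dim_col b = N"
    "dim_row p = N" "dim_col p = N + N" "dim_row q = N" "dim_col q = N + N"
    by (simp_all add: abpq)
  have pq: "p * a = 1\<^sub>m N" "p * b = 0\<^sub>m N N" "q * a = 0\<^sub>m N N" "q * b = 1\<^sub>m N"
    by (simp_all add: abpq)
  note [simp] = mtuplesD(2,3)[OF mt(1)] mtuplesD(2,3)[OF mt(2)] mtuplesD(2,3)[OF mt(3)] mtuplesD(2,3)[OF mt(4)]
  have [simp]: "dim_row (A i) = n" "dim_col (A i) = m" "dim_row (B i) = m" "dim_col (B i) = l"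
    "dim_row (K i) = N" "dim_col (K i) = N" "dim_row (H i) = N" "dim_col (H i) = N" for i
    by (simp_all add: A B K H)
  have KH: "K \<in> mtuples N" "H \<in> mtuples N" by (auto intro!: mtuplesI)
  have upI: "tuple_upper P L P i * a = a * P i" "tuple_upper P L P i * b = a * L i + b * P i"
    if "L \<in> mtuples N" for L i
    unfolding tuple_upper_def abpq
    by (rule upper_mat_inj_proj; simp add: mtuplesD[OF that] mtuplesD[OF mt(4)])+
  have dsum: "tuple_dsum L L i = a * L i * p + b * L i * q" if "L \<in> mtuples N" for L :: "'g mtuple" and i
  proof -
    have "tuple_dsum L L i = upper_mat (L i) (0\<^sub>m N N) (L i)"
      by (simp add: tuple_dsum_upper[OF that that] tuple_upper_def)
    then show ?thesis
      using mtuplesD[OF that] by (simp add: upper_mat_expand[of _ N _ N] abpq mat_ring)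
  qed
  note pij = mult_left_eq[OF pq(1)] mult_left_eq[OF pq(2)] mult_left_eq[OF pq(3)] mult_left_eq[OF pq(4)]
  note jij = mult_left_eq[OF JI(1)] mult_left_eq[OF JI(2)] mult_left_eq[OF JI(3)]
    mult_left_eq[OF JI(4)] mult_left_eq[OF JI(5)] mult_left_eq[OF JI(6)]
    mult_left_eq[OF JI(7)] mult_left_eq[OF JI(8)] mult_left_eq[OF JI(9)]
  note pij' = mult_left_eq[OF PI(1)] mult_left_eq[OF PI(2)] mult_left_eq[OF PI(3)]
  have NN: "N + N > 0" using pos by simp
  show "J1 * (fst_mat N N * T (N + N) (tuple_pair (tuple_upper P K P) (tuple_dsum H H)) j * inr_mat N N) * I3 =
    diff_block n l X Z (\<lambda>i. U * B i) j - U * diff_block m l Y Z B j"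
  proof -
    define \<Phi> where "\<Phi> = tuple_upper P K P"
    \<comment> \<open>The column \<open>b * I2\<close> is not an intertwiner: \<open>\<Phi>\<close>
      sends it to \<open>b I2 Y + a I1 (X U - U Y)\<close>. Subtracting \<open>a * I1 * U\<close>
      absorbs the second term.\<close>
    define \<phi> where "\<phi> = b * I2 - a * I1 * U"
    \<comment> \<open>\<open>H \<oplus> H\<close> is cut into three directions: its upper copy
      \<open>G1\<close>, which kills the block column \<open>b * I3\<close>, and its lower copy with
      \<open>b * I2\<close> rewritten as \<open>\<phi> + a * I1 * U\<close>, which gives
      \<open>G2\<close> and \<open>G3\<close>.\<close>
    define G1 where "G1 = (\<lambda>i. a * I2 * B i * J3 * p)"
    define G2 where "G2 = (\<lambda>i. \<phi> * B i * J3 * q)"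
    define G3 where "G3 = (\<lambda>i. a * I1 * U * B i * J3 * q)"
    have \<Phi>: "\<Phi> \<in> \<Omega> (N + N)" by (simp add: \<Phi>_def up)
    have \<Phi>I: "\<Phi> i * a = a * P i" "\<Phi> i * b = a * K i + b * P i" for i
      by (simp_all add: \<Phi>_def upI KH)
    have [simp]: "dim_row (\<Phi> i) = N + N" "dim_col (\<Phi> i) = N + N" "dim_row \<phi> = N + N" "dim_col \<phi> = m" for i
      by (simp_all add: \<Phi>_def tuple_upper_def \<phi>_def)
    have G: "G1 \<in> mtuples (N + N)" "G2 \<in> mtuples (N + N)" "G3 \<in> mtuples (N + N)"
      by (auto simp: G1_def G2_def G3_def intro!: mtuplesI)
    have \<Phi>1: "\<Phi> i * (a * I1) = a * I1 * X i" for i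
      by (simp add: mat_ring \<Phi>I pij')
    have \<Phi>3: "\<Phi> i * (b * I3) = b * I3 * Z i" for i
      by (simp add: mat_ring \<Phi>I K jij pij')
    have \<Phi>2: "\<Phi> i * \<phi> = \<phi> * Y i" for i
      by (simp add: \<phi>_def mat_ring \<Phi>I K jij pij' A) (rule eq_matI; simp del: index_mult_mat(1))
    have e1: "T (N + N) (tuple_pair \<Phi> G1) j * (b * I3) = 0\<^sub>m (N + N) l"
      by (rule T_kernel[OF NN pos(3) \<Phi> mem(3) G(1) _ \<Phi>3])
        (auto simp: G1_def mat_ring pij intro!: carrier_matI)
    have e2: "T (N + N) (tuple_pair \<Phi> G2) j * (b * I3) = \<phi> * diff_block m l Y Z B j"
      by (rule diff_block_intertwine[OF pos(2,3) NN mem(2,3) \<Phi> G(2) _ _ _ \<Phi>2 \<Phi>3])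
        (auto simp: G2_def \<phi>_def mat_ring pij jij intro!: carrier_matI)
    have e3: "T (N + N) (tuple_pair \<Phi> G3) j * (b * I3) = a * I1 * diff_block n l X Z (\<lambda>i. U * B i) j"
      by (rule diff_block_intertwine[OF pos(1,3) NN mem(1,3) \<Phi> G(3) _ _ _ \<Phi>1 \<Phi>3])
        (auto simp: G3_def mat_ring pij jij intro!: carrier_matI)
    have "tuple_dsum H H = tuple_add (tuple_add G1 G2) G3"
      by (rule ext) (simp add: dsum[OF KH(2)] tuple_add_def, simp add: G1_def G2_def G3_def \<phi>_def H mat_ring,
        rule eq_matI; simp del: index_mult_mat(1))
    then have "T (N + N) (tuple_pair \<Phi> (tuple_dsum H H)) j = T (N + N) (tuple_pair \<Phi> G1) j
        + T (N + N) (tuple_pair \<Phi> G2) j + T (N + N) (tuple_pair \<Phi> G3) j"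
      using G by (simp add: T_add[OF NN \<Phi>])
    then have "T (N + N) (tuple_pair \<Phi> (tuple_dsum H H)) j * (b * I3) =
        \<phi> * diff_block m l Y Z B j + a * I1 * diff_block n l X Z (\<lambda>i. U * B i) j"
      using mtuplesD[OF T_mtuples[OF NN \<Phi> G(1)]] mtuplesD[OF T_mtuples[OF NN \<Phi> G(2)]]
        mtuplesD[OF T_mtuples[OF NN \<Phi> G(3)]]
      by (simp add: add_mult_dim e1 e2 e3 add_zero_dim)
    \<comment> \<open>The row \<open>J1 * p\<close> sends \<open>\<phi>\<close> to
      \<open>- U\<close> and \<open>a * I1\<close> to the identity.\<close>
    then have "J1 * p * (T (N + N) (tuple_pair \<Phi> (tuple_dsum H H)) j * (b * I3)) =
        diff_block n l X Z (\<lambda>i. U * B i) j - U * diff_block m l Y Z B j"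
      by (simp add: \<phi>_def mat_ring pij jij JI) (rule eq_matI; simp del: index_mult_mat(1))
    moreover have "tuple_dsum H H \<in> mtuples (N + N)" by (rule tuple_dsum_mtuples[OF KH(2) KH(2)])
    ultimately show ?thesis
      using mtuplesD[OF T_mtuples[OF NN \<Phi>, of "tuple_dsum H H"]]
      by (simp add: mult_assoc_dim flip: abpq \<Phi>_def)
  qed
  assume "tuple_upper P H P \<in> \<Omega> (N + N)"
  show "J1 * (fst_mat N N * T (N + N) (tuple_pair (tuple_upper P H P) (tuple_dsum K K)) j * inr_mat N N) * I3 =
    diff_block n l X Z (\<lambda>i. - (A i * V)) j + diff_block n m X Y A j * V"
  proof -
    define \<Phi> where "\<Phi> = tuple_upper P H P"
    \<comment> \<open>As with \<open>\<phi>\<close> above: the correction \<open>a * I2 * V\<close>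
      cancels the term \<open>a I2 (Y V - V Z)\<close> that \<open>\<Phi>\<close> adds to
      \<open>b * I3\<close>.\<close>
    define \<psi> where "\<psi> = b * I3 - a * I2 * V"
    define G1 where "G1 = (\<lambda>i. a * I1 * A i * J2 * p)"
    define G2 where "G2 = (\<lambda>i. b * I1 * A i * J2 * q)"
    have \<Phi>: "\<Phi> \<in> \<Omega> (N + N)" by (simp add: \<Phi>_def \<open>tuple_upper P H P \<in> \<Omega> (N + N)\<close>)
    have \<Phi>I: "\<Phi> i * a = a * P i" "\<Phi> i * b = a * H i + b * P i" for i
      by (simp_all add: \<Phi>_def upI KH)
    have [simp]: "dim_row (\<Phi> i) = N + N" "dim_col (\<Phi> i) = N + N" "dim_row \<psi> = N + N" "dim_col \<psi> = l" for i
      by (simp_all add: \<Phi>_def tuple_upper_def \<psi>_def)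
    have G: "G1 \<in> mtuples (N + N)" "G2 \<in> mtuples (N + N)"
      by (auto simp: G1_def G2_def intro!: mtuplesI)
    have \<Phi>1: "\<Phi> i * (a * I1) = a * I1 * X i" for i
      by (simp add: mat_ring \<Phi>I pij')
    have \<Phi>2: "\<Phi> i * (a * I2) = a * I2 * Y i" for i
      by (simp add: mat_ring \<Phi>I pij')
    have \<Phi>3: "\<Phi> i * \<psi> = \<psi> * Z i" for i
      by (simp add: \<psi>_def mat_ring \<Phi>I H jij pij' B) (rule eq_matI; simp del: index_mult_mat(1))
    have e1: "T (N + N) (tuple_pair \<Phi> G1) j * (a * I2) = a * I1 * diff_block n m X Y A j"
      by (rule diff_block_intertwine[OF pos(1,2) NN mem(1,2) \<Phi> G(1) _ _ _ \<Phi>1 \<Phi>2])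
        (auto simp: G1_def mat_ring pij jij intro!: carrier_matI)
    have G1\<psi>: "G1 i * \<psi> = a * I1 * - (A i * V)" for i
      by (simp add: G1_def \<psi>_def mat_ring pij jij uminus_mult_dim)
        (rule eq_matI; simp del: index_mult_mat(1))
    have e2: "T (N + N) (tuple_pair \<Phi> G1) j * \<psi> = a * I1 * diff_block n l X Z (\<lambda>i. - (A i * V)) j"
      by (rule diff_block_intertwine[OF pos(1,3) NN mem(1,3) \<Phi> G(1) _ _ _ \<Phi>1 \<Phi>3 _ G1\<psi>])
        (auto simp: G1_def mat_ring pij jij intro!: carrier_matI)
    have e3: "T (N + N) (tuple_pair \<Phi> G2) j * (a * I2) = 0\<^sub>m (N + N) m"
      by (rule T_kernel[OF NN pos(2) \<Phi> mem(2) G(2) _ \<Phi>2])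
        (auto simp: G2_def mat_ring pij intro!: carrier_matI)
    have e4: "T (N + N) (tuple_pair \<Phi> G2) j * \<psi> = 0\<^sub>m (N + N) l"
      by (rule T_kernel[OF NN pos(3) \<Phi> mem(3) G(2) _ \<Phi>3])
        (auto simp: G2_def \<psi>_def mat_ring pij jij intro!: carrier_matI)
    \<comment> \<open>The last block column is split into intertwiners. \<open>G2\<close> kills both
      parts; \<open>G1\<close> maps \<open>\<psi>\<close> to the direction \<open>- A V\<close>
      between \<open>X\<close> and \<open>Z\<close>, and \<open>a * I2\<close> to the direction
      \<open>A\<close> between \<open>X\<close> and \<open>Y\<close>.\<close>
    have b: "b * I3 = \<psi> + a * I2 * V"
      by (rule eq_matI; simp add: \<psi>_def del: index_mult_mat(1))
    have "tuple_dsum K K = tuple_add G1 G2"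
      by (rule ext) (simp add: dsum[OF KH(1)] tuple_add_def, simp add: G1_def G2_def K mat_ring)
    then have TK: "T (N + N) (tuple_pair \<Phi> (tuple_dsum K K)) j = T (N + N) (tuple_pair \<Phi> G1) j
        + T (N + N) (tuple_pair \<Phi> G2) j"
      using G by (simp add: T_add[OF NN \<Phi>])
    have "T (N + N) (tuple_pair \<Phi> (tuple_dsum K K)) j * (b * I3) =
        a * I1 * diff_block n l X Z (\<lambda>i. - (A i * V)) j + a * I1 * diff_block n m X Y A j * V"
      using mtuplesD[OF T_mtuples[OF NN \<Phi> G(1)]] mtuplesD[OF T_mtuples[OF NN \<Phi> G(2)]]
      unfolding TK b
      by (simp add: add_mult_dim mult_add_dim e2 e4 add_zero_dim mult_assoc_dim[of _ "a * I2" V] e1 e3 mult_zero_dim)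
    then have "J1 * p * (T (N + N) (tuple_pair \<Phi> (tuple_dsum K K)) j * (b * I3)) =
        diff_block n l X Z (\<lambda>i. - (A i * V)) j + diff_block n m X Y A j * V"
      by (simp add: mat_ring pij jij JI)
    moreover have "tuple_dsum K K \<in> mtuples (N + N)" by (rule tuple_dsum_mtuples[OF KH(1) KH(1)])
    ultimately show ?thesis
      using mtuplesD[OF T_mtuples[OF NN \<Phi>, of "tuple_dsum K K"]]
      by (simp add: mult_assoc_dim flip: abpq \<Phi>_def)
  qed
qed

end

text \<open>The curl condition is stated through the upper right blocks that represent
  \<open>DT(P,H)[K,0]\<close> and \<open>DT(P,K)[H,0]\<close>, so that the construction of the
  potential is pure matrix algebra.\<close>

locale curl_free_vf = free_vf \<Omega> T
  for \<Omega> :: "nat \<Rightarrow> 'g::finite mtuple set"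
    and T :: "nat \<Rightarrow> ('g + 'g) mtuple \<Rightarrow> 'h::finite mtuple" +
  assumes upper_mem: "N > 0 \<Longrightarrow> P \<in> \<Omega> N \<Longrightarrow> K \<in> mtuples N \<Longrightarrow> tuple_upper P K P \<in> \<Omega> (N + N)"
    and curl: "N > 0 \<Longrightarrow> P \<in> \<Omega> N \<Longrightarrow> H \<in> mtuples N \<Longrightarrow> K \<in> mtuples N \<Longrightarrow>
      fst_mat N N * T (N + N) (tuple_pair (tuple_upper P K P) (tuple_dsum H H)) j * inr_mat N N =
      fst_mat N N * T (N + N) (tuple_pair (tuple_upper P H P) (tuple_dsum K K)) j * inr_mat N N"
begin

text \<open>The operator \<open>\<Delta>(X,Y)(W)\<close> of the overview: a potential turns it into
  \<open>f(X) W - W f(Y)\<close>.\<close>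

definition comm_block :: "nat \<Rightarrow> nat \<Rightarrow> 'g mtuple \<Rightarrow> 'g mtuple \<Rightarrow> complex mat \<Rightarrow> 'h mtuple" where
  "comm_block n m X Y W = diff_block n m X Y (\<lambda>i. X i * W - W * Y i)"

lemma comm_block_carrier [simp]:
  "comm_block n m X Y W j \<in> carrier_mat n m"
  "dim_row (comm_block n m X Y W j) = n" "dim_col (comm_block n m X Y W j) = m"
  by (simp_all add: comm_block_def)

lemma comm_block_linear:
  assumes "n > 0" "m > 0" "X \<in> \<Omega> n" "Y \<in> \<Omega> m"
    and [simp]: "dim_row U = n" "dim_col U = m" "dim_row V = n" "dim_col V = m"
  shows "comm_block n m X Y (c \<cdot>\<^sub>m U + V) j = c \<cdot>\<^sub>m comm_block n m X Y U j + comm_block n m X Y V j"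
proof -
  note [simp] = mtuplesD(2,3)[OF free_setD(1)[OF free assms(1,3)]] mtuplesD(2,3)[OF free_setD(1)[OF free assms(2,4)]]
  have "(\<lambda>i. X i * (c \<cdot>\<^sub>m U + V) - (c \<cdot>\<^sub>m U + V) * Y i) =
      (\<lambda>i. c \<cdot>\<^sub>m (X i * U - U * Y i) + (X i * V - V * Y i))"
    by (rule ext, rule eq_matI; simp add: mat_ring algebra_simps del: index_mult_mat(1))
  then show ?thesis
    unfolding comm_block_def
    by (simp only:) (rule diff_block_linear[OF assms(1-4)]; auto intro!: carrier_matI)
qed

text \<open>Vanishing curl at \<open>X \<oplus> Y \<oplus> Z\<close> equates the two evaluations of
  the \<open>(1,3)\<close> block. By the telescoping
  \<open>U (Y V - V Z) = (X U V - U V Z) - (X U - U Y) V\<close> the value at \<open>- A V\<close>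
  occurs on both sides and cancels, which leaves the product rule.\<close>

lemma comm_block_derivation:
  assumes "n > 0" "m > 0" "l > 0" "X \<in> \<Omega> n" "Y \<in> \<Omega> m" "Z \<in> \<Omega> l"
    and UV [simp]: "dim_row U = n" "dim_col U = m" "dim_row V = m" "dim_col V = l"
  shows "comm_block n l X Z (U * V) j = U * comm_block m l Y Z V j + comm_block n m X Y U j * V"
proof -
  define P where "P = tuple_dsum (tuple_dsum X Y) Z"
  define N where "N = n + m + l"
  have XY: "tuple_dsum X Y \<in> \<Omega> (n + m)" using assms free_setD(2)[OF free] by blast
  have P: "P \<in> \<Omega> N" unfolding P_def N_def using assms free_setD(2)[OF free _ _ XY] by simp
  have N: "N > 0" using assms by (simp add: N_def)
  note mt = free_setD(1)[OF free assms(1,4)] free_setD(1)[OF free assms(2,5)]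
    free_setD(1)[OF free assms(3,6)] tuple_dsum_mtuples[OF free_setD(1)[OF free assms(1,4)] free_setD(1)[OF free assms(2,5)]]
  note [simp] = mtuplesD(2,3)[OF mt(1)] mtuplesD(2,3)[OF mt(2)] mtuplesD(2,3)[OF mt(3)] mtuplesD(2,3)[OF mt(4)]
    mtuplesD(2,3)[OF tuple_dsum_mtuples[OF mt(4,3)]]
  define A where "A = (\<lambda>i. X i * U - U * Y i)"
  define B where "B = (\<lambda>i. Y i * V - V * Z i)"
  define I1 where "I1 = inl_mat (n + m) l * inl_mat n m"
  define I2 where "I2 = inl_mat (n + m) l * inr_mat n m"
  define I3 where "I3 = inr_mat (n + m) l"
  define J1 where "J1 = fst_mat n m * fst_mat (n + m) l"
  define J2 where "J2 = snd_mat n m * fst_mat (n + m) l"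
  define J3 where "J3 = snd_mat (n + m) l"
  note IJ = I1_def I2_def I3_def J1_def J2_def J3_def
  define K where "K = (\<lambda>i. I1 * A i * J2)"
  define H where "H = (\<lambda>i. I2 * B i * J3)"
  note pij = mult_left_eq[OF proj_inj_mat(1)] mult_left_eq[OF proj_inj_mat(2)]
    mult_left_eq[OF proj_inj_mat(3)] mult_left_eq[OF proj_inj_mat(4)]
  note eqs = tuple_dsum_inj_proj[OF mt(1,2)]
  note eqs' = tuple_dsum_inj_proj[OF mt(4,3)]
  have KH: "K \<in> mtuples N" "H \<in> mtuples N"
    by (auto simp: K_def H_def IJ N_def intro!: mtuplesI)
  have [simp]: "dim_row (A i) = n" "dim_col (A i) = m" "dim_row (B i) = m" "dim_col (B i) = l" for i
    by (simp_all add: A_def B_def)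
  have PI: "P i * I1 = I1 * X i" "P i * I2 = I2 * Y i" "P i * I3 = I3 * Z i" for i
    by (simp_all add: P_def IJ mat_ring eqs' mult_left_eq[OF eqs(1)] mult_left_eq[OF eqs(2)])
  have dims: "dim_row I1 = N" "dim_col I1 = n" "dim_row I2 = N" "dim_col I2 = m" "dim_row I3 = N" "dim_col I3 = l"
    "dim_row J1 = n" "dim_col J1 = N" "dim_row J2 = m" "dim_col J2 = N" "dim_row J3 = l" "dim_col J3 = N"
    by (simp_all add: IJ N_def)
  have JI: "J1 * I1 = 1\<^sub>m n" "J1 * I2 = 0\<^sub>m n m" "J1 * I3 = 0\<^sub>m n l"
      "J2 * I1 = 0\<^sub>m m n" "J2 * I2 = 1\<^sub>m m" "J2 * I3 = 0\<^sub>m m l"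
      "J3 * I1 = 0\<^sub>m l n" "J3 * I2 = 0\<^sub>m l m" "J3 * I3 = 1\<^sub>m l"
    by (simp_all add: IJ mat_ring pij)
  note aux = diff_block_derivation_aux[OF assms(1-3) N assms(4-6) P dims PI JI UV A_def B_def K_def H_def upper_mem[OF N P KH(1)], of j]
  have eq: "diff_block n l X Z (\<lambda>i. U * B i) j - U * diff_block m l Y Z B j =
      diff_block n l X Z (\<lambda>i. - (A i * V)) j + diff_block n m X Y A j * V"
    unfolding aux(1)[symmetric] aux(2)[OF upper_mem[OF N P KH(2)], symmetric]
    by (simp only: curl[OF N P KH(2,1)])
  \<comment> \<open>The scalar 1 gives the sum the shape that \<open>diff_block_linear\<close>
    expects.\<close>
  have "(\<lambda>i. U * B i) = (\<lambda>i. 1 \<cdot>\<^sub>m (X i * (U * V) - U * V * Z i) + - (A i * V))"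
    by (rule ext, rule eq_matI; simp add: A_def B_def mat_ring del: index_mult_mat(1))
  then have "diff_block n l X Z (\<lambda>i. U * B i) j =
      comm_block n l X Z (U * V) j + diff_block n l X Z (\<lambda>i. - (A i * V)) j"
    by (simp only: comm_block_def, subst diff_block_linear[OF assms(1,3,4,6)])
      (auto simp: smult_one_zero intro!: carrier_matI)
  with eq have "comm_block n l X Z (U * V) j + diff_block n l X Z (\<lambda>i. - (A i * V)) j - U * diff_block m l Y Z B j =
      diff_block n l X Z (\<lambda>i. - (A i * V)) j + diff_block n m X Y A j * V" by simp
  then have "comm_block n l X Z (U * V) j = U * diff_block m l Y Z B j + diff_block n m X Y A j * V"
  proof (intro eq_matI, goal_cases)
    case (1 r c)
    from 1(1) have "(comm_block n l X Z (U * V) j + diff_block n l X Z (\<lambda>i. - (A i * V)) j - U * diff_block m l Y Z B j) $$ (r, c) =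
      (diff_block n l X Z (\<lambda>i. - (A i * V)) j + diff_block n m X Y A j * V) $$ (r, c)" by simp
    with 1(2,3) show ?case by (simp add: algebra_simps del: index_mult_mat(1))
  qed auto
  then show ?thesis by (simp add: comm_block_def A_def B_def)
qed

lemma comm_block_zero:
  assumes "n > 0" "m > 0" "X \<in> \<Omega> n" "Y \<in> \<Omega> m" "\<And>i. X i * W = W * Y i" "W \<in> carrier_mat n m"
  shows "comm_block n m X Y W j = 0\<^sub>m n m"
proof -
  note [simp] = mtuplesD(2,3)[OF free_setD(1)[OF free assms(1,3)]] mtuplesD(2,3)[OF free_setD(1)[OF free assms(2,4)]]
    carrier_matD[OF assms(6)]
  have XY: "tuple_dsum X Y \<in> \<Omega> (n + m)" using assms free_setD(2)[OF free] by blast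
  have "(\<lambda>i. inl_mat n m * (X i * W - W * Y i) * snd_mat n m) = tuple_zero (n + m)"
    by (simp add: assms(5) mat_ring tuple_zero_def)
  then show ?thesis
    using assms by (simp add: comm_block_def diff_block_def T_zero[OF _ XY] mat_ring)
qed

end

subsection \<open>The potential\<close>

text \<open>One point \<open>Z0\<close>, at some positive level \<open>m0\<close>, serves as
  reference for the points of all levels.\<close>

locale based_vf = curl_free_vf \<Omega> T
  for \<Omega> :: "nat \<Rightarrow> 'g::finite mtuple set"
    and T :: "nat \<Rightarrow> ('g + 'g) mtuple \<Rightarrow> 'h::finite mtuple" +
  fixes m0 :: nat and Z0 :: "'g mtuple"
  assumes m0: "m0 > 0" and Z0: "Z0 \<in> \<Omega> m0"
begin

text \<open>The matrix \<open>u e\<^sub>1\<^sup>T\<close>, which makes a vector \<open>u\<close> a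
  morphism between \<open>Z0\<close> and a point of level \<open>n\<close>. Column 0 exists because
  \<open>m0 > 0\<close>.\<close>

definition first_col :: "nat \<Rightarrow> (nat \<Rightarrow> complex) \<Rightarrow> complex mat" where
  "first_col n u = mat n m0 (\<lambda>(a, b). if b = 0 then u a else 0)"

text \<open>Intended as the \<open>r\<close>-th coordinate of the vector
  \<open>f(X) u\<close>.\<close>

definition col_fun :: "nat \<Rightarrow> 'g mtuple \<Rightarrow> 'h \<Rightarrow> nat \<Rightarrow> (nat \<Rightarrow> complex) \<Rightarrow> complex" where
  "col_fun n X j r u = comm_block n m0 X Z0 (first_col n u) j $$ (r, 0)"

definition unit_fun :: "nat \<Rightarrow> nat \<Rightarrow> complex" where
  "unit_fun k = (\<lambda>a. if a = k then 1 else 0)"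

definition potential :: "nat \<Rightarrow> 'g mtuple \<Rightarrow> 'h mtuple" where
  "potential n X = (\<lambda>j. mat n n (\<lambda>(r, k). col_fun n X j r (unit_fun k)))"

lemma potential_mtuples: "potential n X \<in> mtuples n"
  by (simp add: mtuples_def potential_def)

lemma col_fun_linear:
  assumes "n > 0" "X \<in> \<Omega> n" "r < n"
  shows "col_fun n X j r (\<lambda>a. c * u a + v a) = c * col_fun n X j r u + col_fun n X j r v"
proof -
  have "first_col n (\<lambda>a. c * u a + v a) = c \<cdot>\<^sub>m first_col n u + first_col n v"
    by (rule eq_matI) (auto simp: first_col_def)
  then show ?thesis
    using assms m0 Z0 by (simp add: col_fun_def comm_block_linear first_col_def)
qed

lemma col_fun_sum:
  assumes "n > 0" "X \<in> \<Omega> n" "r < n"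
  shows "col_fun n X j r u = (\<Sum>k<n. u k * col_fun n X j r (unit_fun k))"
proof -
  \<comment> \<open>Linearity covers two summands only, so the expansion in unit vectors goes by
    induction on a finite support.\<close>
  have "col_fun n X j r (\<lambda>a. if a \<in> S then u a else 0) = (\<Sum>k\<in>S. u k * col_fun n X j r (unit_fun k))"
    if "finite S" for S
    using that
  proof (induction S)
    case empty
    then show ?case using col_fun_linear[OF assms, of j "-1" "\<lambda>_. 0" "\<lambda>_. 0"] by simp
  next
    case (insert k S)
    have "(\<lambda>a. if a \<in> insert k S then u a else 0) = (\<lambda>a. u k * unit_fun k a + (if a \<in> S then u a else 0))"
      using insert.hyps by (auto simp: unit_fun_def fun_eq_iff)
    then show ?case using insert by (simp only: col_fun_linear[OF assms]) simp
  qed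
  from this[of "{..<n}"] have "col_fun n X j r (\<lambda>a. if a < n then u a else 0) =
    (\<Sum>k<n. u k * col_fun n X j r (unit_fun k))" by simp
  moreover have "first_col n (\<lambda>a. if a < n then u a else 0) = first_col n u"
    by (rule eq_matI) (auto simp: first_col_def)
  ultimately show ?thesis by (simp add: col_fun_def)
qed

text \<open>Columnwise, this is the derivation rule for \<open>W\<close> times
  \<open>e\<^sub>c e\<^sub>1\<^sup>T\<close> over the points \<open>X\<close>, \<open>Y\<close>,
  \<open>Z0\<close>: the first column of the left side is \<open>f(X)\<close> applied to column
  \<open>c\<close> of \<open>W\<close>, and the two terms on the right give column \<open>c\<close>
  of \<open>W f(Y)\<close> and of \<open>\<Delta>(X,Y)(W)\<close>. Thus the derivation is
  inner.\<close>

lemma potential_comm: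
  assumes "n > 0" "m > 0" "X \<in> \<Omega> n" "Y \<in> \<Omega> m" "W \<in> carrier_mat n m"
  shows "potential n X j * W = comm_block n m X Y W j + W * potential m Y j"
proof (rule eq_matI, goal_cases)
  case (1 r c)
  note [simp] = carrier_matD[OF assms(5)]
  have rc: "r < n" "c < m" using 1 by (simp_all add: potential_def)
  have fc: "first_col n (\<lambda>a. W $$ (a, c)) = W * first_col m (unit_fun c)"
    using rc by (intro eq_matI) (auto simp: first_col_def unit_fun_def scalar_prod_def if_distrib[of "(*) _"] cong: if_cong)
  have [simp]: "dim_row (first_col k u) = k" "dim_col (first_col k u) = m0" for k u
    by (simp_all add: first_col_def)
  have "(potential n X j * W) $$ (r, c) = (\<Sum>k<n. W $$ (k, c) * col_fun n X j r (unit_fun k))"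
    using rc by (simp add: scalar_prod_def potential_def atLeast0LessThan mult.commute)
  also have "\<dots> = col_fun n X j r (\<lambda>a. W $$ (a, c))"
    by (rule col_fun_sum[OF assms(1,3) rc(1), symmetric])
  also have "\<dots> = (W * comm_block m m0 Y Z0 (first_col m (unit_fun c)) j) $$ (r, 0)
      + (comm_block n m X Y W j * first_col m (unit_fun c)) $$ (r, 0)"
    using rc m0 by (simp add: col_fun_def fc comm_block_derivation[OF assms(1,2) m0 assms(3,4) Z0] del: index_mult_mat(1))
  also have "(W * comm_block m m0 Y Z0 (first_col m (unit_fun c)) j) $$ (r, 0) = (W * potential m Y j) $$ (r, c)"
    using rc m0 by (simp add: scalar_prod_def potential_def col_fun_def)
  also have "(comm_block n m X Y W j * first_col m (unit_fun c)) $$ (r, 0) = comm_block n m X Y W j $$ (r, c)"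
    using rc m0 by (simp add: scalar_prod_def first_col_def unit_fun_def if_distrib[of "(*) _"] cong: if_cong)
  finally show ?case using rc by (simp add: potential_def del: index_mult_mat(1))
qed (simp_all add: potential_def carrier_matD[OF assms(5)])

lemma potential_intertwine:
  assumes "n > 0" "m > 0" "X \<in> \<Omega> n" "Y \<in> \<Omega> m" "W \<in> carrier_mat n m" "\<And>i. X i * W = W * Y i"
  shows "potential n X j * W = W * potential m Y j"
  using potential_comm[OF assms(1-5), of j] comm_block_zero[OF assms(1-4,6,5)] assms(5)
    mtuplesD(1)[OF potential_mtuples[of m Y], of j] by simp

text \<open>Both freeness conditions are instances of intertwining: the injections of the summands
  intertwine \<open>X \<oplus> Y\<close> with \<open>X\<close> and \<open>Y\<close>, and
  \<open>S\<close> intertwines \<open>X\<close> with its conjugate.\<close>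

lemma free_map_potential: "free_map \<Omega> potential"
  unfolding free_map_def
proof (intro conjI allI impI ballI, goal_cases)
  case 1
  show ?case by (rule potential_mtuples)
next
  case (2 n m X Y)
  note mt = free_setD(1)[OF free 2(1,3)] free_setD(1)[OF free 2(2,4)]
  have XY: "tuple_dsum X Y \<in> \<Omega> (n + m)" using 2 free_setD(2)[OF free] by blast
  note dims [simp] = mtuplesD(2,3)[OF potential_mtuples]
  have 1: "potential (n + m) (tuple_dsum X Y) j * inl_mat n m = inl_mat n m * potential n X j" for j
    using 2 XY by (intro potential_intertwine) (auto simp: tuple_dsum_inj_proj[OF mt] intro!: carrier_matI)
  have 3: "potential (n + m) (tuple_dsum X Y) j * inr_mat n m = inr_mat n m * potential m Y j" for j
    using 2 XY by (intro potential_intertwine) (auto simp: tuple_dsum_inj_proj[OF mt] intro!: carrier_matI)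
  show ?case
  proof
    fix j
    let ?F = "potential (n + m) (tuple_dsum X Y) j"
    \<comment> \<open>Inserting the decomposition of the identity determines the matrix from its two
      block columns.\<close>
    have "?F = ?F * (inl_mat n m * fst_mat n m + inr_mat n m * snd_mat n m)"
      by (simp add: inj_proj_sum)
    also have "\<dots> = tuple_dsum (potential n X) (potential m Y) j"
      using mtuplesD(1)[OF potential_mtuples[of n X], of j] mtuplesD(1)[OF potential_mtuples[of m Y], of j]
      by (simp add: mat_ring 1 3 tuple_dsum_upper[OF potential_mtuples potential_mtuples] tuple_upper_def
          upper_mat_expand[of _ n _ m])
    finally show "?F = tuple_dsum (potential n X) (potential m Y) j" .
  qed
next
  case (3 n X P)
  obtain S S' where P: "P = (S, S')" by fastforce
  with 3 have S: "S \<in> carrier_mat n n" "S' \<in> carrier_mat n n" "S * S' = 1\<^sub>m n" "S' * S = 1\<^sub>m n"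
    by (auto simp: GL_pairs_def inverts_mat_def)
  note mt = free_setD(1)[OF free 3(1,2)]
  note [simp] = mtuplesD(2,3)[OF mt] mtuplesD(2,3)[OF potential_mtuples] carrier_matD[OF S(1)] carrier_matD[OF S(2)]
  have X': "tuple_conj P X \<in> \<Omega> n" using 3 free_setD(3)[OF free] by blast
  have "potential n X j * S = S * potential n (tuple_conj P X) j" for j
    by (rule potential_intertwine[OF 3(1,1,2) X' S(1)]) (simp add: P tuple_conj_def mat_ring S(3))
  then have "S' * (potential n X j * S) = S' * (S * potential n (tuple_conj P X) j)" for j by simp
  then show ?case
    by (simp add: fun_eq_iff tuple_conj_def P mat_ring S(4))
qed

text \<open>The relation \<open>potential_comm\<close> is applied to \<open>\<Phi>\<close>,
  \<open>X\<close> and the second injection, whose intertwining defect is the first injection times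
  \<open>H\<close>. The first projection removes the term with \<open>f(X)\<close>, and what remains
  is the diagonal value of \<open>diff_block\<close>.\<close>

lemma potential_upper:
  assumes "n > 0" "X \<in> \<Omega> n" "H \<in> mtuples n"
  shows "fst_mat n n * potential (n + n) (tuple_upper X H X) j * inr_mat n n = T n (tuple_pair X H) j"
proof -
  define \<Phi> where "\<Phi> = tuple_upper X H X"
  have \<Phi>: "\<Phi> \<in> \<Omega> (n + n)" using assms by (simp add: \<Phi>_def upper_mem)
  have n2: "n + n > 0" using assms by simp
  note mt = free_setD(1)[OF free assms(1,2)] free_setD(1)[OF free n2 \<Phi>]
  have \<Phi>X: "tuple_dsum \<Phi> X \<in> \<Omega> (n + n + n)" by (rule free_setD(2)[OF free n2 assms(1) \<Phi> assms(2)])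
  note [simp] = mtuplesD(2,3)[OF potential_mtuples] mtuplesD(2,3)[OF mt(1)] mtuplesD(2,3)[OF mt(2)]
    mtuplesD(2,3)[OF assms(3)] mtuplesD(2,3)[OF T_mtuples[OF assms]]
  have \<Phi>I: "\<Phi> i * inl_mat n n = inl_mat n n * X i"
    "\<Phi> i * inr_mat n n = inl_mat n n * H i + inr_mat n n * X i" for i
    unfolding \<Phi>_def tuple_upper_def
    by (rule upper_mat_inj_proj; simp add: mtuplesD[OF mt(1)] mtuplesD[OF assms(3)])+
  note eqs = tuple_dsum_inj_proj[OF mt(2,1)]
  define B where "B = (\<lambda>i. inl_mat n n * H i)"
  have "(\<lambda>i. \<Phi> i * inr_mat n n - inr_mat n n * X i) = B"
    by (rule ext, rule eq_matI; simp add: \<Phi>I B_def del: index_mult_mat(1))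
  then have "potential (n + n) \<Phi> j * inr_mat n n = diff_block (n + n) n \<Phi> X B j + inr_mat n n * potential n X j"
    using potential_comm[OF n2 assms(1) \<Phi> assms(2) carrier_matI, of "inr_mat n n" j]
    by (simp add: comm_block_def)
  then have "fst_mat n n * potential (n + n) \<Phi> j * inr_mat n n = fst_mat n n * diff_block (n + n) n \<Phi> X B j"
    by (simp add: mat_ring flip: mult_assoc_dim) (simp add: mat_ring)
  \<comment> \<open>The first injection intertwines \<open>\<Phi>\<close> with \<open>X\<close>, so
    it can be pulled out and the first point replaced by \<open>X\<close>.\<close>
  also have "diff_block (n + n) n \<Phi> X B j = inl_mat n n * diff_block n n X X H j"
  proof -
    let ?G = "\<lambda>i. inl_mat (n + n) n * B i * snd_mat (n + n) n"
    let ?T = "T (n + n + n) (tuple_pair (tuple_dsum \<Phi> X) ?G) j"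
    have "?T * inr_mat (n + n) n = inl_mat (n + n) n * inl_mat n n * diff_block n n X X H j"
    proof (rule diff_block_intertwine[OF assms(1,1) _ assms(2,2) \<Phi>X corner_mtuples])
      show "tuple_dsum \<Phi> X i * (inl_mat (n + n) n * inl_mat n n) = inl_mat (n + n) n * inl_mat n n * X i" for i
        using mtuplesD[OF tuple_dsum_mtuples[OF mt(2,1)]]
        by (simp add: mat_ring eqs mult_left_eq[OF \<Phi>I(1)])
      show "tuple_dsum \<Phi> X i * inr_mat (n + n) n = inr_mat (n + n) n * X i" for i by (simp add: eqs)
    qed (auto simp: B_def mat_ring assms mult_left_eq[OF proj_inj_mat(3)] mult_left_eq[OF proj_inj_mat(4)]
        intro!: carrier_matI)
    then have "fst_mat (n + n) n * (?T * inr_mat (n + n) n) = inl_mat n n * diff_block n n X X H j"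
      by (simp add: mat_ring)
    moreover have "fst_mat (n + n) n * ?T * inr_mat (n + n) n = fst_mat (n + n) n * (?T * inr_mat (n + n) n)"
      using mtuplesD(2,3)[OF T_mtuples[OF _ \<Phi>X corner_mtuples, of B]] n2
      by (intro mult_assoc_dim[symmetric]) simp_all
    ultimately show ?thesis by (simp only: diff_block_def[of "n + n"])
  qed
  finally show ?thesis
    by (simp add: diff_block_diag[OF assms] mat_ring flip: \<Phi>_def)
qed

end

subsection \<open>Derivatives of analytic free maps\<close>

lemma openin_tuple_topology:
  "openin (tuple_topology n) V \<longleftrightarrow> (\<exists>U. open U \<and> V = entries n -` U \<inter> mtuples n)"
  by (simp add: tuple_topology_def openin_pullback_topology)

lemma topspace_tuple_topology: "topspace (tuple_topology n) = mtuples n"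
  by (simp add: tuple_topology_def topspace_pullback_topology)

lemma tendsto_fun_coordinatewise:
  fixes f :: "'a \<Rightarrow> 'i \<Rightarrow> 'b::topological_space"
  assumes "\<And>i. ((\<lambda>z. f z i) \<longlongrightarrow> l i) F"
  shows "(f \<longlongrightarrow> l) F"
proof -
  have "limitin (product_topology (\<lambda>i. euclidean) UNIV) f l F"
    using assms by (simp add: limitin_componentwise)
  then show ?thesis by (simp add: euclidean_product_topology)
qed

lemma limitin_tuple_topologyI:
  assumes "L \<in> mtuples n" "\<forall>\<^sub>F z in F. f z \<in> mtuples n"
    and "\<And>q. q \<in> UNIV \<times> {..<n} \<times> {..<n} \<Longrightarrow> ((\<lambda>z. entries n (f z) q) \<longlongrightarrow> entries n L q) F"
  shows "limitin (tuple_topology n) f L F"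
  unfolding limitin_def topspace_tuple_topology
proof (intro conjI allI impI)
  fix V assume "openin (tuple_topology n) V \<and> L \<in> V"
  then obtain U where U: "open U" "V = entries n -` U \<inter> mtuples n" "entries n L \<in> U"
    by (auto simp: openin_tuple_topology)
  have "((\<lambda>z. entries n (f z)) \<longlongrightarrow> entries n L) F"
  proof (rule tendsto_fun_coordinatewise)
    fix q show "((\<lambda>z. entries n (f z) q) \<longlongrightarrow> entries n L q) F"
    proof (cases "q \<in> UNIV \<times> {..<n} \<times> {..<n}")
      \<comment> \<open>Positions outside the \<open>n \<times> n\<close> range carry the default
        value 0 for every tuple, so convergence there is trivial.\<close>
      case False
      then have "entries n X q = 0" for X by (auto simp: entries_def split: prod.splits)
      then show ?thesis by simp
    qed (rule assms(3))
  qed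
  then have "\<forall>\<^sub>F z in F. entries n (f z) \<in> U" using U by (auto simp: tendsto_def)
  with assms(2) show "\<forall>\<^sub>F z in F. f z \<in> V" by eventually_elim (simp add: U)
qed (rule assms(1))

lemma limitin_tuple_topology_entries:
  assumes "limitin (tuple_topology n) f L F"
  shows "((\<lambda>z. entries n (f z) q) \<longlongrightarrow> entries n L q) F"
  unfolding tendsto_def
proof (intro allI impI)
  fix S assume S: "open S" "entries n L q \<in> S"
  have "open ((\<lambda>x. x q) -` S)"
    by (rule open_vimage[OF S(1) continuous_on_product_coordinates])
  then have "openin (tuple_topology n) (entries n -` ((\<lambda>x. x q) -` S) \<inter> mtuples n)"
    by (auto simp: openin_tuple_topology)
  with assms S have "\<forall>\<^sub>F z in F. f z \<in> entries n -` ((\<lambda>x. x q) -` S) \<inter> mtuples n"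
    by (auto simp: limitin_def topspace_tuple_topology)
  then show "\<forall>\<^sub>F z in F. entries n (f z) q \<in> S" by (rule eventually_mono) auto
qed

lemma entries_inject:
  assumes "X \<in> mtuples n" "Y \<in> mtuples n" "entries n X = entries n Y"
  shows "X = Y"
proof
  fix i
  have "X i $$ (r, c) = Y i $$ (r, c)" if "r < n" "c < n" for r c
    using fun_cong[OF assms(3), of "(i, r, c)"] that by (simp add: entries_def)
  then show "X i = Y i"
    using mtuplesD(2,3)[OF assms(1)] mtuplesD(2,3)[OF assms(2)] by (intro eq_matI) simp_all
qed

text \<open>The definite description needs a unique limit: limits of the entries are unique in the
  complex numbers, and the entries determine a tuple of size \<open>n\<close>.\<close>

lemma free_deriv_eqI:
  assumes "limitin (tuple_topology n)
    (\<lambda>z. tuple_scale (1 / z) (tuple_diff (f n (tuple_add X (tuple_scale z H))) (f n X))) L (at (0::complex))"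
  shows "free_deriv f n X H = L"
  unfolding free_deriv_def
proof (rule the_equality)
  show "limitin (tuple_topology n)
    (\<lambda>z. tuple_scale (1 / z) (tuple_diff (f n (tuple_add X (tuple_scale z H))) (f n X))) L (at (0::complex))"
    by (rule assms)
  fix L' assume L': "limitin (tuple_topology n)
    (\<lambda>z. tuple_scale (1 / z) (tuple_diff (f n (tuple_add X (tuple_scale z H))) (f n X))) L' (at (0::complex))"
  have "entries n L' = entries n L"
    using limitin_tuple_topology_entries[OF L'] limitin_tuple_topology_entries[OF assms]
    by (intro ext tendsto_unique[OF at_neq_bot])
  with L' assms show "L' = L"
    by (intro entries_inject) (auto simp: limitin_def topspace_tuple_topology)
qed

lemma entries_line:
  assumes "A \<in> mtuples n" "B \<in> mtuples n"
  shows "entries n (tuple_add A (tuple_scale z B)) p = entries n A p + z * entries n B p"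
  using mtuplesD(2,3)[OF assms(1)] mtuplesD(2,3)[OF assms(2)]
  by (auto simp: entries_def tuple_add_def tuple_scale_def split: prod.splits)

lemma line_in_open:
  assumes "openin (tuple_topology n) V" "A \<in> V" "B \<in> mtuples n"
  shows "\<exists>e>0. \<forall>z. norm z < e \<longrightarrow> tuple_add A (tuple_scale z B) \<in> V"
proof -
  obtain U where U: "open U" "V = entries n -` U \<inter> mtuples n"
    using assms(1) by (auto simp: openin_tuple_topology)
  have A: "A \<in> mtuples n" using assms U by auto
  let ?h = "\<lambda>z p. entries n A p + z * entries n B p"
  have "continuous_on UNIV ?h"
    by (intro continuous_on_coordinatewise_then_product continuous_intros)
  then have "open (?h -` U)" by (rule open_vimage[OF U(1)])
  moreover have "0 \<in> ?h -` U" using assms(2) U by simp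
  ultimately obtain e where e: "e > 0" "ball 0 e \<subseteq> ?h -` U" by (meson open_contains_ball)
  have "tuple_add A (tuple_scale z B) \<in> V" if "norm z < e" for z
  proof -
    have "?h z \<in> U" using e(2) that by auto
    moreover have "entries n (tuple_add A (tuple_scale z B)) = ?h z"
      by (rule ext) (rule entries_line[OF A assms(3)])
    ultimately show ?thesis using A assms(3) by (simp add: U(2))
  qed
  with e(1) show ?thesis by blast
qed

text \<open>The constant term of the series at \<open>z = 0\<close> survives because of \<open>0 ^ 0 = 1\<close>.\<close>

lemma has_sum_graded_tendsto:
  fixes t :: "'i \<Rightarrow> complex" and d :: "'i \<Rightarrow> nat"
  assumes "e > 0" and sums: "\<And>z. norm z < e \<Longrightarrow> ((\<lambda>\<alpha>. t \<alpha> * z ^ d \<alpha>) has_sum g z) I"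
  shows "(g \<longlongrightarrow> g 0) (at 0)"
proof -
  define \<rho> where "\<rho> = e / 2"
  have \<rho>: "\<rho> > 0" "\<rho> < e" using assms(1) by (auto simp: \<rho>_def)
  have "norm (complex_of_real \<rho>) < e" using \<rho> by simp
  then have "(\<lambda>\<alpha>. t \<alpha> * of_real \<rho> ^ d \<alpha>) summable_on I" using sums has_sum_imp_summable by blast
  then have abs: "(\<lambda>\<alpha>. norm (t \<alpha> * of_real \<rho> ^ d \<alpha>)) summable_on I"
    by (simp add: summable_on_iff_abs_summable_on_complex)
  define M where "M = (\<Sum>\<^sub>\<infinity>\<alpha>\<in>I. norm (t \<alpha> * of_real \<rho> ^ d \<alpha>))"
  have M: "((\<lambda>\<alpha>. norm (t \<alpha> * of_real \<rho> ^ d \<alpha>)) has_sum M) I"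
    unfolding M_def using abs by simp
  \<comment> \<open>From each nonconstant term one factor \<open>z\<close> is split off and the
    remaining power is compared with radius \<open>\<rho>\<close>, where \<open>\<rho> < e\<close>
    ensures absolute convergence.\<close>
  have bound: "norm (g z - g 0) \<le> norm z / \<rho> * M" if "norm z < \<rho>" for z
  proof (rule norm_infsum_le)
    show "((\<lambda>\<alpha>. t \<alpha> * z ^ d \<alpha> - t \<alpha> * 0 ^ d \<alpha>) has_sum (g z - g 0)) I"
      using has_sum_add[OF sums has_sum_cmult_right[OF sums, of 0 "-1"], of z] that \<rho> assms(1) by simp
    show "((\<lambda>\<alpha>. norm z / \<rho> * norm (t \<alpha> * of_real \<rho> ^ d \<alpha>)) has_sum (norm z / \<rho> * M)) I"
      by (intro has_sum_cmult_right M)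
    fix \<alpha> assume "\<alpha> \<in> I"
    show "norm (t \<alpha> * z ^ d \<alpha> - t \<alpha> * 0 ^ d \<alpha>) \<le> norm z / \<rho> * norm (t \<alpha> * of_real \<rho> ^ d \<alpha>)"
    proof (cases "d \<alpha>")
      case (Suc k)
      have "norm z ^ k \<le> \<rho> ^ k" using that by (intro power_mono) auto
      then have "norm (t \<alpha>) * (norm z * norm z ^ k) \<le> norm (t \<alpha>) * (norm z * \<rho> ^ k)"
        by (intro mult_left_mono) auto
      then show ?thesis using \<rho> Suc by (simp add: norm_mult norm_power field_simps)
    qed (use \<rho> in simp)
  qed
  have "((\<lambda>z::complex. norm z / \<rho> * M) \<longlongrightarrow> norm (0::complex) / \<rho> * M) (at 0)"
    by (intro tendsto_intros) (use \<rho> in auto)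
  then have "((\<lambda>z::complex. norm z / \<rho> * M) \<longlongrightarrow> 0) (at 0)" by simp
  moreover have "\<forall>\<^sub>F z in at 0. norm (g z - g 0) \<le> norm z / \<rho> * M"
    using \<rho> bound by (auto simp: eventually_at intro!: exI[of _ \<rho>])
  ultimately have "((\<lambda>z. g z - g 0) \<longlongrightarrow> 0) (at 0)"
    by (rule Lim_null_comparison[rotated])
  then show ?thesis by (simp add: LIM_zero_iff)
qed

text \<open>Along the line \<open>A + z B\<close> a monomial becomes a constant times
  \<open>z\<close> to its total degree, so the local expansion is a graded series in
  \<open>z\<close>. Only continuity along lines is extracted here, since freeness will turn
  derivatives into values.\<close>

lemma analytic_free_line:
  assumes an: "analytic_free \<Omega> F" and "n > 0" "A \<in> \<Omega> n" "A \<in> mtuples n" "B \<in> mtuples n"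
    and q: "q \<in> UNIV \<times> {..<n} \<times> {..<n}"
  shows "((\<lambda>z. entries n (F n (tuple_add A (tuple_scale z B))) q) \<longlongrightarrow> entries n (F n A) q) (at 0)"
    and "\<forall>\<^sub>F z in at 0. tuple_add A (tuple_scale z B) \<in> \<Omega> n"
proof -
  let ?P = "UNIV \<times> {..<n} \<times> {..<n}"
  obtain V a where V: "openin (tuple_topology n) V" "A \<in> V" "V \<subseteq> \<Omega> n"
    and sums: "\<And>X. X \<in> V \<Longrightarrow> ((\<lambda>\<alpha>. a \<alpha> * (\<Prod>p\<in>?P. (entries n X p - entries n A p) ^ \<alpha> p))
                    has_sum entries n (F n X) q) (multi_indices n)"
    using an assms(2,3) q unfolding analytic_free_def by meson
  obtain e where e: "e > 0" "\<And>z. norm z < e \<Longrightarrow> tuple_add A (tuple_scale z B) \<in> V"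
    using line_in_open[OF V(1,2) assms(5)] by blast
  show "\<forall>\<^sub>F z in at 0. tuple_add A (tuple_scale z B) \<in> \<Omega> n"
    using e V(3) by (auto simp: eventually_at)
  have A0: "tuple_add A (tuple_scale 0 B) = A"
    by (rule entries_inject[of _ n]) (simp_all add: entries_line assms(4,5) fun_eq_iff)
  have "((\<lambda>\<alpha>. (a \<alpha> * (\<Prod>p\<in>?P. entries n B p ^ \<alpha> p)) * z ^ (\<Sum>p\<in>?P. \<alpha> p))
      has_sum entries n (F n (tuple_add A (tuple_scale z B))) q) (multi_indices n)" if "norm z < e" for z
    using sums[OF e(2)[OF that]]
    by (simp add: entries_line assms(4,5) power_mult_distrib prod.distrib power_sum mult_ac)
  from has_sum_graded_tendsto[OF e(1) this]
  show "((\<lambda>z. entries n (F n (tuple_add A (tuple_scale z B))) q) \<longlongrightarrow> entries n (F n A) q) (at 0)"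
    by (simp add: A0)
qed

section \<open>Block triangular points and the corner formula for the derivative\<close>

lemma scaled_one_GL_pairs:
  assumes "z \<noteq> 0"
  shows "(upper_mat (z \<cdot>\<^sub>m 1\<^sub>m n) (0\<^sub>m n m) (1\<^sub>m m), upper_mat ((1 / z) \<cdot>\<^sub>m 1\<^sub>m n) (0\<^sub>m n m) (1\<^sub>m m)) \<in> GL_pairs (n + m)"
proof -
  have "upper_mat (1\<^sub>m n) (0\<^sub>m n m) (1\<^sub>m m) = 1\<^sub>m (n + m)"
    by (rule eq_matI) (auto simp: upper_mat_def)
  then show ?thesis
    using assms
    by (simp add: GL_pairs_def inverts_mat_def upper_mat_mult[of _ n _ m] mat_ring smult_smult_mult smult_one_zero)
qed

text \<open>A neighbourhood of \<open>X \<oplus> X\<close> inside \<open>\<Omega>\<close> contains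
  the points with a small corner \<open>z H\<close>; conjugation by the block diagonal matrix with
  entries \<open>z\<close> and \<open>1\<close> rescales this corner to \<open>H\<close>.\<close>

lemma upper_mem:
  assumes "free_set \<Omega>" "analytic_free \<Omega> (F :: nat \<Rightarrow> _ \<Rightarrow> 'h::finite mtuple)" "n > 0" "X \<in> \<Omega> n" "H \<in> mtuples n"
  shows "tuple_upper X H X \<in> \<Omega> (n + n)"
proof -
  have X: "X \<in> mtuples n" using free_setD(1)[OF assms(1)] assms by blast
  define B where "B = tuple_upper (tuple_zero n) H (tuple_zero n)"
  have B: "B \<in> mtuples (n + n)" by (simp add: B_def tuple_upper_mtuples)
  have XX: "tuple_dsum X X \<in> \<Omega> (n + n)" using assms free_setD(2) by blast
  \<comment> \<open>Any entry will do: only the neighbourhood that comes with its power series is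
    wanted.\<close>
  have "(undefined, 0, 0) \<in> (UNIV :: 'h set) \<times> {..<n + n} \<times> {..<n + n}" using assms by simp
  from analytic_free_line(2)[OF assms(2) _ XX tuple_dsum_mtuples[OF X X] B this] assms(3)
  have "\<forall>\<^sub>F z in at 0. tuple_add (tuple_dsum X X) (tuple_scale z B) \<in> \<Omega> (n + n) \<and> z \<noteq> 0"
    by (auto intro!: eventually_conj simp: eventually_neq_at_within)
  from eventually_happens[OF this] obtain z
    where z: "z \<noteq> 0" "tuple_add (tuple_dsum X X) (tuple_scale z B) \<in> \<Omega> (n + n)" by auto
  let ?P = "(upper_mat (z \<cdot>\<^sub>m 1\<^sub>m n) (0\<^sub>m n n) (1\<^sub>m n), upper_mat ((1 / z) \<cdot>\<^sub>m 1\<^sub>m n) (0\<^sub>m n n) (1\<^sub>m n))"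
  note dims [simp] = mtuplesD[OF X] mtuplesD[OF assms(5)]
  have "tuple_conj ?P (tuple_add (tuple_dsum X X) (tuple_scale z B)) = tuple_upper X H X"
  proof
    fix i
    have "tuple_add (tuple_dsum X X) (tuple_scale z B) i = upper_mat (X i) (z \<cdot>\<^sub>m H i) (X i)"
      unfolding tuple_dsum_upper[OF X X] tuple_add_def tuple_scale_def B_def tuple_upper_def tuple_zero_def
      by (rule eq_matI) (auto simp: upper_mat_def)
    then show "tuple_conj ?P (tuple_add (tuple_dsum X X) (tuple_scale z B)) i = tuple_upper X H X i"
      using z(1) by (simp add: tuple_conj_def tuple_upper_def upper_mat_mult[of _ n _ n] mat_ring
          smult_smult_mult smult_one_zero)
  qed
  then show ?thesis
    using free_setD(3)[OF assms(1) _ z(2) scaled_one_GL_pairs[OF z(1)]] assms(3) by simp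
qed

text \<open>For \<open>z \<noteq> 0\<close> the corner of \<open>F\<close> at the matrix with rows
  \<open>X + z H, H\<close> and \<open>0, X\<close> is exactly the difference quotient. Continuity
  along a line then gives both the existence of the limit and its value.\<close>

lemma free_deriv_upper:
  assumes "free_set \<Omega>" "free_map \<Omega> F" "analytic_free \<Omega> F" "n > 0" "X \<in> \<Omega> n" "H \<in> mtuples n"
  shows "free_deriv F n X H = (\<lambda>j. fst_mat n n * F (n + n) (tuple_upper X H X) j * inr_mat n n)"
proof (rule free_deriv_eqI, rule limitin_tuple_topologyI)
  have X: "X \<in> mtuples n" using free_setD(1)[OF assms(1)] assms by blast
  have n2: "n + n > 0" using assms(4) by simp
  define \<Phi> where "\<Phi> = (\<lambda>z. tuple_upper (tuple_add X (tuple_scale z H)) H X)"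
  define B where "B = tuple_upper H (tuple_zero n) (tuple_zero n)"
  have B: "B \<in> mtuples (n + n)" by (simp add: B_def tuple_upper_mtuples assms(6))
  note dims [simp] = mtuplesD[OF X] mtuplesD[OF assms(6)]
  have up: "tuple_upper X H X \<in> \<Omega> (n + n)" by (rule upper_mem[OF assms(1,3-6)])
  have \<Phi>: "tuple_add (tuple_upper X H X) (tuple_scale z B) = \<Phi> z" for z
    unfolding \<Phi>_def B_def tuple_add_def tuple_scale_def tuple_upper_def tuple_zero_def
    by (rule ext, rule eq_matI) (auto simp: upper_mat_def)
  have q0: "(undefined, 0, 0) \<in> UNIV \<times> {..<n} \<times> {..<n}" "(undefined, 0, 0) \<in> UNIV \<times> {..<n + n} \<times> {..<n + n}"
    using assms(4) by auto
  have ev: "\<forall>\<^sub>F z in at 0. \<Phi> z \<in> \<Omega> (n + n) \<and> tuple_add X (tuple_scale z H) \<in> \<Omega> n \<and> z \<noteq> 0"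
    using analytic_free_line(2)[OF assms(3) n2 up tuple_upper_mtuples[OF X X] B q0(2)]
      analytic_free_line(2)[OF assms(3,4,5) X assms(6) q0(1)]
    by (intro eventually_conj) (simp_all add: \<Phi> eventually_neq_at_within)
  let ?Q = "\<lambda>z. tuple_scale (1 / z) (tuple_diff (F n (tuple_add X (tuple_scale z H))) (F n X))"
  have quot: "?Q z = (\<lambda>j. fst_mat n n * F (n + n) (\<Phi> z) j * inr_mat n n)"
    if *: "\<Phi> z \<in> \<Omega> (n + n)" "tuple_add X (tuple_scale z H) \<in> \<Omega> n" "z \<noteq> 0" for z
  proof
    fix j
    define Xz where "Xz = tuple_add X (tuple_scale z H)"
    \<comment> \<open>The first injection intertwines \<open>\<Phi> z\<close> with
      \<open>X + z H\<close>. Subtracting \<open>1 / z\<close> times it from the second cancels the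
      corner \<open>H\<close> and leaves an intertwiner with \<open>X\<close>.\<close>
    define W where "W = inr_mat n n - (1 / z) \<cdot>\<^sub>m inl_mat n n"
    have Xz: "Xz \<in> \<Omega> n" "Xz \<in> mtuples n" using *(2) X assms(6) by (auto simp: Xz_def)
    note [simp] = mtuplesD[OF Xz(2)] mtuplesD(2,3)[OF free_mapD(1)[OF assms(2) n2 *(1)]]
      mtuplesD(2,3)[OF free_mapD(1)[OF assms(2,4,5)]] mtuplesD(2,3)[OF free_mapD(1)[OF assms(2,4) Xz(1)]]
      mtuplesD(2,3)[OF free_setD(1)[OF assms(1) n2 *(1)]]
    have \<Phi>I: "\<Phi> z i * inl_mat n n = inl_mat n n * Xz i"
      "\<Phi> z i * inr_mat n n = inl_mat n n * H i + inr_mat n n * X i" for i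
      unfolding \<Phi>_def tuple_upper_def Xz_def[symmetric] by (rule upper_mat_inj_proj; simp)+
    have W [simp]: "dim_row W = n + n" "dim_col W = n" by (simp_all add: W_def)
    have "\<Phi> z i * W = W * X i" for i
      using *(3) by (simp add: W_def mat_ring \<Phi>I)
        (rule eq_matI; simp add: Xz_def tuple_add_def tuple_scale_def mat_ring field_simps del: index_mult_mat(1))
    then have 1: "F (n + n) (\<Phi> z) j * W = W * F n X j"
      by (intro free_map_intertwine[OF assms(1,2) n2 assms(4) *(1) assms(5)]) (auto intro!: carrier_matI)
    have 2: "F (n + n) (\<Phi> z) j * inl_mat n n = inl_mat n n * F n Xz j"
      by (intro free_map_intertwine[OF assms(1,2) n2 assms(4) *(1) Xz(1)]) (auto simp: \<Phi>I intro!: carrier_matI)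
    have inr: "inr_mat n n = W + (1 / z) \<cdot>\<^sub>m inl_mat n n"
      by (rule eq_matI) (auto simp: W_def)
    have "F (n + n) (\<Phi> z) j * inr_mat n n = W * F n X j + (1 / z) \<cdot>\<^sub>m (inl_mat n n * F n Xz j)"
      unfolding inr by (simp add: mult_add_dim smult_mult_dim 1 2)
    then have "fst_mat n n * (F (n + n) (\<Phi> z) j * inr_mat n n) =
        fst_mat n n * (W * F n X j + (1 / z) \<cdot>\<^sub>m (inl_mat n n * F n Xz j))" by simp
    also have "\<dots> = (1 / z) \<cdot>\<^sub>m (F n Xz j - F n X j)"
      by (simp add: W_def mat_ring) (rule eq_matI; simp add: algebra_simps del: index_mult_mat(1))
    finally show "?Q z j = fst_mat n n * F (n + n) (\<Phi> z) j * inr_mat n n"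
      by (simp add: tuple_scale_def tuple_diff_def mult_assoc_dim Xz_def)
  qed
  have FX: "F n X \<in> mtuples n" by (rule free_mapD(1)[OF assms(2,4,5)])
  show "(\<lambda>j. fst_mat n n * F (n + n) (tuple_upper X H X) j * inr_mat n n) \<in> mtuples n"
    by (rule mtuplesI) simp_all
  show "\<forall>\<^sub>F z in at 0. ?Q z \<in> mtuples n"
    using ev by eventually_elim (auto intro!: tuple_ops_mtuples FX free_mapD(1)[OF assms(2,4)])
  fix q :: "'b \<times> nat \<times> nat" assume "q \<in> UNIV \<times> {..<n} \<times> {..<n}"
  then obtain j r c where q: "q = (j, r, c)" "r < n" "c < n" by auto
  have ent: "entries n (\<lambda>j. fst_mat n n * F (n + n) Y j * inr_mat n n) q = entries (n + n) (F (n + n) Y) (j, r, n + c)"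
    if "Y \<in> \<Omega> (n + n)" for Y
    using q mtuplesD(2,3)[OF free_mapD(1)[OF assms(2) n2 that]]
    by (simp add: entries_def mult_inr_mat fst_mat_mult)
  have "((\<lambda>z. entries (n + n) (F (n + n) (\<Phi> z)) (j, r, n + c)) \<longlongrightarrow>
      entries (n + n) (F (n + n) (tuple_upper X H X)) (j, r, n + c)) (at 0)"
    using analytic_free_line(1)[OF assms(3) n2 up tuple_upper_mtuples[OF X X] B, of "(j, r, n + c)"] q
    by (simp add: \<Phi>)
  moreover have "\<forall>\<^sub>F z in at 0. entries (n + n) (F (n + n) (\<Phi> z)) (j, r, n + c) = entries n (?Q z) q"
    using ev by eventually_elim (simp add: quot ent)
  ultimately show "((\<lambda>z. entries n (?Q z) q) \<longlongrightarrow>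
      entries n (\<lambda>j. fst_mat n n * F (n + n) (tuple_upper X H X) j * inr_mat n n) q) (at 0)"
    unfolding ent[OF up] by (rule Lim_transform_eventually)
qed

subsection \<open>Analyticity of the potential\<close>

text \<open>Substituting for each variable either \<open>0\<close> or another variable regroups a power series along the
  finite fibres of the induced map on exponents.\<close>

lemma has_sum_substitute:
  fixes \<sigma> :: "'p \<Rightarrow> 'q option" and a :: "('p \<Rightarrow> nat) \<Rightarrow> complex" and y :: "'q \<Rightarrow> complex"
  assumes fin: "finite P" "finite Q" and \<sigma>: "\<And>p q. p \<in> P \<Longrightarrow> \<sigma> p = Some q \<Longrightarrow> q \<in> Q"
  defines "push \<equiv> \<lambda>\<alpha> q. \<Sum>p\<in>{p\<in>P. \<sigma> p = Some q}. \<alpha> p"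
  defines "fib \<equiv> \<lambda>\<beta>. {\<alpha>. (\<forall>p. p \<notin> P \<longrightarrow> \<alpha> p = 0) \<and> (\<forall>p\<in>P. \<sigma> p = None \<longrightarrow> \<alpha> p = 0) \<and> push \<alpha> = \<beta>}"
  assumes sums: "((\<lambda>\<alpha>. a \<alpha> * (\<Prod>p\<in>P. (case \<sigma> p of None \<Rightarrow> 0 | Some q \<Rightarrow> y q) ^ \<alpha> p)) has_sum s)
      {\<alpha>. \<forall>p. p \<notin> P \<longrightarrow> \<alpha> p = 0}"
  shows "((\<lambda>\<beta>. sum a (fib \<beta>) * (\<Prod>q\<in>Q. y q ^ \<beta> q)) has_sum s) {\<beta>. \<forall>q. q \<notin> Q \<longrightarrow> \<beta> q = 0}"
proof -
  define M where "M = {\<alpha>. (\<forall>p. p \<notin> P \<longrightarrow> \<alpha> p = 0) \<and> (\<forall>p\<in>P. \<sigma> p = None \<longrightarrow> \<alpha> p = (0::nat))}"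
  define t where "t = (\<lambda>\<alpha>. a \<alpha> * (\<Prod>q\<in>Q. y q ^ push \<alpha> q))"
  let ?I = "{\<beta>. \<forall>q. q \<notin> Q \<longrightarrow> \<beta> q = (0::nat)}"
  have push_out: "push \<alpha> q = 0" if "q \<notin> Q" for \<alpha> q
  proof -
    have none: "{p\<in>P. \<sigma> p = Some q} = {}" using \<sigma> that by blast
    show ?thesis unfolding push_def none by simp
  qed
  \<comment> \<open>A positive power of a variable replaced by 0 kills its monomial, while
    \<open>0 ^ 0 = 1\<close> keeps the others; hence only the exponents in \<open>M\<close>
    matter.\<close>
  have "(t has_sum s) M"
  proof (rule iffD1[OF has_sum_cong_neutral sums])
    fix \<alpha> assume "\<alpha> \<in> {\<alpha>. \<forall>p. p \<notin> P \<longrightarrow> \<alpha> p = 0} - M"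
    then obtain p where "p \<in> P" "\<sigma> p = None" "\<alpha> p \<noteq> 0" by (auto simp: M_def)
    then have "(\<Prod>p\<in>P. (case \<sigma> p of None \<Rightarrow> 0 | Some q \<Rightarrow> y q) ^ \<alpha> p) = 0"
      using fin by (intro prod_zero) (auto intro!: bexI[of _ p])
    then show "a \<alpha> * (\<Prod>p\<in>P. (case \<sigma> p of None \<Rightarrow> 0 | Some q \<Rightarrow> y q) ^ \<alpha> p) = 0" by simp
  next
    fix \<alpha> assume "\<alpha> \<in> {\<alpha>. \<forall>p. p \<notin> P \<longrightarrow> \<alpha> p = 0} \<inter> M"
    then have \<alpha>: "\<And>p. p \<in> P \<Longrightarrow> \<sigma> p = None \<Longrightarrow> \<alpha> p = 0" by (auto simp: M_def)
    let ?S = "{p\<in>P. \<sigma> p \<noteq> None}"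
    let ?f = "\<lambda>p. (case \<sigma> p of None \<Rightarrow> 0 | Some q \<Rightarrow> y q) ^ \<alpha> p"
    have "(\<Prod>q\<in>Q. y q ^ push \<alpha> q) = (\<Prod>q\<in>Q. prod ?f {p\<in>?S. the (\<sigma> p) = q})"
    proof (rule prod.cong)
      fix q assume "q \<in> Q"
      have "prod ?f {p\<in>?S. the (\<sigma> p) = q} = (\<Prod>p\<in>{p\<in>P. \<sigma> p = Some q}. y q ^ \<alpha> p)"
        by (rule prod.cong) auto
      then show "y q ^ push \<alpha> q = prod ?f {p\<in>?S. the (\<sigma> p) = q}" by (simp add: push_def power_sum)
    qed simp
    also have "\<dots> = prod ?f ?S"
      using fin \<sigma> by (intro prod.group) auto
    also have "\<dots> = prod ?f P"
      using fin \<alpha> by (intro prod.mono_neutral_left) auto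
    finally show "a \<alpha> * prod ?f P = t \<alpha>" by (simp add: t_def)
  qed (auto simp: M_def)
  moreover have "bij_betw snd (Sigma ?I fib) M"
  proof (rule bij_betwI')
    fix x x' assume "x \<in> Sigma ?I fib" "x' \<in> Sigma ?I fib"
    then show "snd x = snd x' \<longleftrightarrow> x = x'" by (auto simp: fib_def)
  next
    fix x assume "x \<in> Sigma ?I fib"
    then show "snd x \<in> M" by (auto simp: fib_def M_def)
  next
    fix \<alpha> assume "\<alpha> \<in> M"
    then have "(push \<alpha>, \<alpha>) \<in> Sigma ?I fib" using push_out by (auto simp: fib_def M_def)
    then show "\<exists>x\<in>Sigma ?I fib. \<alpha> = snd x" by (rule bexI[rotated]) simp
  qed
  ultimately have "((\<lambda>x. t (snd x)) has_sum s) (Sigma ?I fib)"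
    by (simp add: has_sum_reindex_bij_betw)
  then show ?thesis
  proof (rule has_sum_SigmaD)
    fix \<beta> assume "\<beta> \<in> ?I"
    \<comment> \<open>Fibres are finite because each exponent in the fibre over
      \<open>\<beta>\<close> is at most the total degree of \<open>\<beta>\<close>.\<close>
    have "fib \<beta> \<subseteq> {\<alpha>. \<forall>p. (p \<in> P \<longrightarrow> \<alpha> p \<in> {..sum \<beta> Q}) \<and> (p \<notin> P \<longrightarrow> \<alpha> p = 0)}"
    proof
      fix \<alpha> assume \<alpha>: "\<alpha> \<in> fib \<beta>"
      have "\<alpha> p \<le> sum \<beta> Q" if p: "p \<in> P" for p
      proof (cases "\<sigma> p")
        case None
        then show ?thesis using \<alpha> p by (auto simp: fib_def)
      next
        case (Some q)
        have "\<alpha> p \<le> push \<alpha> q" unfolding push_def using fin p Some by (intro member_le_sum) auto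
        also have "push \<alpha> q = \<beta> q" using \<alpha> by (auto simp: fib_def)
        also have "\<beta> q \<le> sum \<beta> Q" using fin \<sigma>[OF p Some] by (intro member_le_sum) auto
        finally show ?thesis .
      qed
      then show "\<alpha> \<in> {\<alpha>. \<forall>p. (p \<in> P \<longrightarrow> \<alpha> p \<in> {..sum \<beta> Q}) \<and> (p \<notin> P \<longrightarrow> \<alpha> p = 0)}"
        using \<alpha> by (auto simp: fib_def)
    qed
    then have "finite (fib \<beta>)"
      by (rule finite_subset) (intro finite_set_of_finite_funs fin finite_atMost)
    then have "(t has_sum sum t (fib \<beta>)) (fib \<beta>)" by (rule has_sum_finite)
    moreover have "sum t (fib \<beta>) = sum a (fib \<beta>) * (\<Prod>q\<in>Q. y q ^ \<beta> q)"
      unfolding sum_distrib_right by (rule sum.cong) (auto simp: t_def fib_def)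
    ultimately show "((\<lambda>\<alpha>. t (snd (\<beta>, \<alpha>))) has_sum (sum a (fib \<beta>) * (\<Prod>q\<in>Q. y q ^ \<beta> q))) (fib \<beta>)"
      by simp
  qed
qed

context based_vf
begin

text \<open>The point and direction at which \<open>T\<close> yields column \<open>k\<close> of the
  potential: the direction has the corner \<open>X W - W Z0\<close> for \<open>W\<close> equal to
  \<open>E\<^sub>k\<^sub>1\<close>.\<close>

definition pot_arg :: "nat \<Rightarrow> nat \<Rightarrow> 'g mtuple \<Rightarrow> ('g + 'g) mtuple" where
  "pot_arg n k X = tuple_pair (tuple_dsum X Z0)
    (\<lambda>i. inl_mat n m0 * (X i * first_col n (unit_fun k) - first_col n (unit_fun k) * Z0 i) * snd_mat n m0)"

text \<open>Each entry of \<open>pot_arg n k X\<close> is a constant plus either \<open>0\<close> or the entry of \<open>X\<close> that \<open>pot_var\<close>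
  selects.\<close>

definition pot_var :: "nat \<Rightarrow> nat \<Rightarrow> ('g + 'g) \<times> nat \<times> nat \<Rightarrow> ('g \<times> nat \<times> nat) option" where
  "pot_var n k = (\<lambda>(s, a, b). case s of
      Inl i \<Rightarrow> if a < n \<and> b < n then Some (i, a, b) else None
    | Inr i \<Rightarrow> if a < n \<and> b = n then Some (i, a, k) else None)"

lemma Z0_mtuples: "Z0 \<in> mtuples m0"
  using free_setD(1)[OF free m0 Z0] .

lemma pot_arg_mem: "n > 0 \<Longrightarrow> X \<in> \<Omega> n \<Longrightarrow> pot_arg n k X \<in> times_mtuples \<Omega> (n + m0)"
  unfolding pot_arg_def mem_times_mtuples
  by (intro conjI corner_mtuples free_setD(2)[OF free _ m0 _ Z0])

lemma pot_arg_mtuples: "X \<in> mtuples n \<Longrightarrow> pot_arg n k X \<in> mtuples (n + m0)"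
  unfolding pot_arg_def tuple_pair_mtuples by (intro conjI corner_mtuples tuple_dsum_mtuples Z0_mtuples)

text \<open>Column \<open>n\<close> of the large matrix is the first column of its upper right
  block.\<close>

lemma entries_potential:
  assumes "n > 0" "X \<in> \<Omega> n" "r < n" "k < n"
  shows "entries n (potential n X) (j, r, k) = entries (n + m0) (T (n + m0) (pot_arg n k X)) (j, r, n)"
proof -
  have "T (n + m0) (pot_arg n k X) \<in> mtuples (n + m0)"
    by (rule free_mapD(1)[OF free_T _ pot_arg_mem]) (use assms in auto)
  from mtuplesD(2,3)[OF this] show ?thesis
    using assms m0 by (simp add: entries_def potential_def col_fun_def comm_block_def diff_block_def
        fst_mat_mult mult_inr_mat del: index_mult_mat(1) flip: pot_arg_def)
qed

text \<open>In the corner, \<open>X W\<close> contributes column \<open>k\<close> of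
  \<open>X\<close> to the first column and nothing elsewhere, while \<open>W Z0\<close> is constant.
  The constants are recorded by evaluating the formula at the zero tuple, which may lie outside
  \<open>\<Omega>\<close>.\<close>

lemma entries_pot_arg:
  assumes X: "X \<in> mtuples n" and k: "k < n"
  shows "entries (n + m0) (pot_arg n k X) p =
    entries (n + m0) (pot_arg n k (tuple_zero n)) p +
      (case pot_var n k p of None \<Rightarrow> 0 | Some q \<Rightarrow> entries n X q)"
proof -
  note [simp] = mtuplesD(2,3)[OF Z0_mtuples] mtuplesD(2,3)[OF X]
  have [simp]: "dim_row (first_col n u) = n" "dim_col (first_col n u) = m0" for u
    by (simp_all add: first_col_def)
  have col: "(M * first_col n (unit_fun k)) $$ (a, b) = (if b = 0 then M $$ (a, k) else 0)"
    if "dim_row M = n" "dim_col M = n" "a < n" "b < m0" for M a b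
    using that k by (simp add: first_col_def unit_fun_def scalar_prod_def if_distrib[of "(*) _"] cong: if_cong)
  obtain s a b where p: "p = (s, a, b)" by (cases p) auto
  show ?thesis
  proof (cases s)
    case (Inl i)
    then show ?thesis
      by (auto simp: p pot_arg_def pot_var_def entries_def tuple_dsum_def tuple_zero_def)
  next
    case (Inr i)
    have "entries (n + m0) (pot_arg n k Y) p = (if a < n \<and> n \<le> b \<and> b < n + m0 then
        (if b = n then Y i $$ (a, k) else 0) - (first_col n (unit_fun k) * Z0 i) $$ (a, b - n) else 0)"
      if "Y \<in> mtuples n" for Y
    proof -
      note [simp] = mtuplesD(2,3)[OF that]
      show ?thesis
        by (auto simp: p Inr pot_arg_def entries_def index_corner col simp del: index_mult_mat(1))
    qed
    from this[OF X] this[OF tuple_ops_mtuples(4)] show ?thesis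
      using k m0 by (auto simp: p Inr pot_var_def entries_def tuple_zero_def)
  qed
qed

text \<open>The power series of \<open>T\<close> at \<open>pot_arg n k A\<close> is pulled back
  along the affine map \<open>pot_arg n k\<close>: in the difference of two values the constants
  cancel, and each variable becomes 0 or one entry of \<open>X - A\<close>.\<close>

lemma analytic_free_potential:
  assumes op: "\<And>n. n > 0 \<Longrightarrow> openin (tuple_topology n) (\<Omega> n)"
    and an: "analytic_free (times_mtuples \<Omega>) T"
  shows "analytic_free \<Omega> potential"
  unfolding analytic_free_def
proof (intro allI impI ballI)
  fix n A and q :: "'h \<times> nat \<times> nat"
  assume n: "n > 0" and A: "A \<in> \<Omega> n" and "q \<in> UNIV \<times> {..<n} \<times> {..<n}"
  then obtain j r k where q: "q = (j, r, k)" "r < n" "k < n" by auto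
  let ?N = "n + m0" and ?L = "pot_arg n k"
  let ?P = "UNIV \<times> {..<n + m0} \<times> {..<n + m0} :: (('g + 'g) \<times> nat \<times> nat) set"
  let ?Q = "UNIV \<times> {..<n} \<times> {..<n} :: ('g \<times> nat \<times> nat) set"
  have mt: "X \<in> mtuples n" if "X \<in> \<Omega> n" for X using free_setD(1)[OF free n that] .
  have "(j, r, n) \<in> UNIV \<times> {..<?N} \<times> {..<?N}" using q m0 by auto
  then obtain V a where V: "openin (tuple_topology ?N) V" "?L A \<in> V" "V \<subseteq> times_mtuples \<Omega> ?N"
    and sums: "\<And>X. X \<in> V \<Longrightarrow> ((\<lambda>\<alpha>. a \<alpha> * (\<Prod>p\<in>?P. (entries ?N X p - entries ?N (?L A) p) ^ \<alpha> p))
                    has_sum entries ?N (T ?N X) (j, r, n)) (multi_indices ?N)"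
    using an n pot_arg_mem[OF n A, of k] unfolding analytic_free_def by (meson add_pos_pos m0)
  from V(1) obtain U where U: "open U" "V = entries ?N -` U \<inter> mtuples ?N"
    by (auto simp: openin_tuple_topology)
  \<comment> \<open>The affine map in coordinates, defined for all families of entries so that its
    continuity yields an open preimage.\<close>
  define h where "h = (\<lambda>y p. entries ?N (?L (tuple_zero n)) p + (case pot_var n k p of None \<Rightarrow> 0 | Some q \<Rightarrow> y q))"
  have h: "entries ?N (?L X) = h (entries n X)" if "X \<in> mtuples n" for X
    unfolding h_def by (rule ext) (rule entries_pot_arg[OF that q(3)])
  have "continuous_on UNIV h"
    unfolding h_def
  proof (rule continuous_on_coordinatewise_then_product)
    fix p show "continuous_on UNIV (\<lambda>y. entries ?N (?L (tuple_zero n)) p + (case pot_var n k p of None \<Rightarrow> 0 | Some q \<Rightarrow> y q))"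
      by (cases "pot_var n k p") (auto intro!: continuous_intros)
  qed
  then have "open (h -` U)" by (rule open_vimage[OF U(1)])
  then have "openin (tuple_topology n) (entries n -` (h -` U) \<inter> mtuples n)"
    by (auto simp: openin_tuple_topology)
  then have "openin (tuple_topology n) (entries n -` (h -` U) \<inter> mtuples n \<inter> \<Omega> n)"
    by (rule openin_Int[OF _ op[OF n]])
  moreover define V' where "V' = entries n -` (h -` U) \<inter> mtuples n \<inter> \<Omega> n"
  ultimately have V': "openin (tuple_topology n) V'" by simp
  have AV: "A \<in> V'" using V(2) A mt[OF A] by (simp add: V'_def U(2) h)
  \<comment> \<open>The regrouped coefficients of \<open>has_sum_substitute\<close>: sums of
    \<open>a\<close> over the exponents that induce the same monomial in \<open>X\<close>.\<close>
  define b where "b = (\<lambda>\<beta>. sum a {\<alpha>. (\<forall>p. p \<notin> ?P \<longrightarrow> \<alpha> p = 0) \<and>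
      (\<forall>p\<in>?P. pot_var n k p = None \<longrightarrow> \<alpha> p = 0) \<and>
      (\<lambda>q. \<Sum>p\<in>{p\<in>?P. pot_var n k p = Some q}. \<alpha> p) = \<beta>})"
  have "((\<lambda>\<beta>. b \<beta> * (\<Prod>p\<in>?Q. (entries n X p - entries n A p) ^ \<beta> p)) has_sum
      entries n (potential n X) q) (multi_indices n)" if X: "X \<in> V'" for X
  proof -
    have X\<Omega>: "X \<in> \<Omega> n" and XV: "?L X \<in> V"
      using X pot_arg_mtuples by (auto simp: V'_def U(2) h)
    have "entries ?N (?L X) p - entries ?N (?L A) p =
        (case pot_var n k p of None \<Rightarrow> 0 | Some q \<Rightarrow> entries n X q - entries n A q)" for p
      unfolding h[OF mt[OF X\<Omega>]] h[OF mt[OF A]] by (simp add: h_def split: option.split)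
    with sums[OF XV] have "((\<lambda>\<alpha>. a \<alpha> * (\<Prod>p\<in>?P. (case pot_var n k p of None \<Rightarrow> 0
        | Some q \<Rightarrow> entries n X q - entries n A q) ^ \<alpha> p)) has_sum entries n (potential n X) q)
        {\<alpha>. \<forall>p. p \<notin> ?P \<longrightarrow> \<alpha> p = 0}"
      by (simp only: q(1) entries_potential[OF n X\<Omega> q(2,3)] multi_indices_def)
    then show ?thesis
      unfolding b_def multi_indices_def
      by (rule has_sum_substitute[rotated 3])
        (use q(3) in \<open>auto simp: pot_var_def split: sum.splits if_splits\<close>)
  qed
  with V' AV show "\<exists>V a. openin (tuple_topology n) V \<and> A \<in> V \<and> V \<subseteq> \<Omega> n \<and>
      (\<forall>X\<in>V. ((\<lambda>\<alpha>. a \<alpha> * (\<Prod>p\<in>UNIV \<times> {..<n} \<times> {..<n}. (entries n X p - entries n A p) ^ \<alpha> p))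
        has_sum entries n (potential n X) q) (multi_indices n))"
    by (intro exI[of _ V'] exI[of _ b]) (auto simp: V'_def)
qed

end

subsection \<open>Symmetry of second derivatives\<close>

text \<open>Exchanging the two middle blocks of a \<open>4 \<times> 4\<close> block matrix exchanges \<open>H\<close> and \<open>K\<close> and fixes
  the upper right corner.\<close>

lemma free_map_corner_sym:
  fixes f :: "nat \<Rightarrow> 'g::finite mtuple \<Rightarrow> 'h::finite mtuple" and j :: 'h
  assumes "free_set \<Omega>" "free_map \<Omega> f" "n > 0" "X \<in> mtuples n" "H \<in> mtuples n" "K \<in> mtuples n"
    and mem: "\<And>H K. H \<in> mtuples n \<Longrightarrow> K \<in> mtuples n \<Longrightarrow>
      tuple_upper (tuple_upper X K X) (tuple_dsum H H) (tuple_upper X K X) \<in> \<Omega> (n + n + (n + n))"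
  defines "corner \<equiv> \<lambda>H K. fst_mat n n * (fst_mat (n + n) (n + n) *
      f (n + n + (n + n)) (tuple_upper (tuple_upper X K X) (tuple_dsum H H) (tuple_upper X K X)) j *
      inr_mat (n + n) (n + n)) * inr_mat n n"
  shows "corner H K = corner K H"
proof -
  define \<Phi> where "\<Phi> = (\<lambda>H K. tuple_upper (tuple_upper X K X) (tuple_dsum H H) (tuple_upper X K X))"
  define N where "N = n + n"
  have N: "N + N > 0" using assms(3) by (simp add: N_def)
  define a b p q where abpq: "a = inl_mat N N" "b = inr_mat N N" "p = fst_mat N N" "q = snd_mat N N"
  define i1 i2 p1 p2 where ip: "i1 = inl_mat n n" "i2 = inr_mat n n" "p1 = fst_mat n n" "p2 = snd_mat n n"
  have [simp]: "dim_row a = N + N" "dim_col a = N" "dim_row b = N + N" "dim_col b = N"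
    "dim_row p = N" "dim_col p = N + N" "dim_row q = N" "dim_col q = N + N"
    "dim_row i1 = N" "dim_col i1 = n" "dim_row i2 = N" "dim_col i2 = n"
    "dim_row p1 = n" "dim_col p1 = N" "dim_row p2 = n" "dim_col p2 = N"
    by (simp_all add: abpq ip N_def)
  \<comment> \<open>The permutation matrix that exchanges the second and third of the four blocks:
    \<open>a * i1\<close>, \<open>a * i2\<close>, \<open>b * i1\<close>, \<open>b * i2\<close> are
    the block injections, and the matching projections occur with the two middle ones
    swapped.\<close>
  define S where "S = a * i1 * p1 * p + a * i2 * p1 * q + b * i1 * p2 * p + b * i2 * p2 * q"
  have S [simp]: "dim_row S = N + N" "dim_col S = N + N" by (simp_all add: S_def)
  note [simp] = mtuplesD(2,3)[OF assms(4)] mtuplesD(2,3)[OF assms(5)] mtuplesD(2,3)[OF assms(6)]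
  have intert: "\<Phi> H K i * S = S * \<Phi> K H i" for i
  proof -
    have Q: "tuple_upper X L X \<in> mtuples N" "tuple_dsum L L \<in> mtuples N" if "L \<in> mtuples n" for L
      using tuple_upper_mtuples[OF assms(4,4)] tuple_dsum_mtuples[OF that that] by (simp_all add: N_def)
    note [simp] = mtuplesD(2,3)[OF Q(1)[OF assms(5)]] mtuplesD(2,3)[OF Q(1)[OF assms(6)]]
      mtuplesD(2,3)[OF Q(2)[OF assms(5)]] mtuplesD(2,3)[OF Q(2)[OF assms(6)]]
    have outer: "\<Phi> H K i * a = a * tuple_upper X K X i" "\<Phi> H K i * b = a * tuple_dsum H H i + b * tuple_upper X K X i"
      "p * \<Phi> K H i = tuple_upper X H X i * p + tuple_dsum K K i * q" "q * \<Phi> K H i = tuple_upper X H X i * q"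
      unfolding \<Phi>_def abpq tuple_upper_def[of "tuple_upper _ _ _"]
      by (rule upper_mat_inj_proj; intro carrier_matI; simp)+
    have inner: "tuple_upper X L X i * i1 = i1 * X i" "tuple_upper X L X i * i2 = i1 * L i + i2 * X i"
      "p1 * tuple_upper X L X i = X i * p1 + L i * p2" "p2 * tuple_upper X L X i = X i * p2"
      if "L \<in> mtuples n" for L
      unfolding tuple_upper_def ip
      by (rule upper_mat_inj_proj; simp add: mtuplesD[OF that] mtuplesD[OF assms(4)])+
    have sums: "tuple_dsum L L i * i1 = i1 * L i" "tuple_dsum L L i * i2 = i2 * L i"
      "p1 * tuple_dsum L L i = L i * p1" "p2 * tuple_dsum L L i = L i * p2" if "L \<in> mtuples n" for L
      unfolding ip by (rule tuple_dsum_inj_proj[OF that that])+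
    have dim\<Phi> [simp]: "dim_row (\<Phi> L M i) = N + N" "dim_col (\<Phi> L M i) = N + N"
      if "L \<in> mtuples n" "M \<in> mtuples n" for L M
      using mtuplesD(2,3)[OF Q(1)[OF that(2)], of i] by (simp_all add: \<Phi>_def tuple_upper_def[of "tuple_upper _ _ _"])
    note dims = dim\<Phi>[OF assms(5,6)] dim\<Phi>[OF assms(6,5)]
    have "\<Phi> H K i * S = a * i1 * X i * p1 * p + a * i1 * K i * p1 * q + a * i2 * X i * p1 * q
        + a * i1 * H i * p2 * p + b * i1 * X i * p2 * p + a * i2 * H i * p2 * q + b * i1 * K i * p2 * q
        + b * i2 * X i * p2 * q"
      by (simp add: S_def mat_ring dims outer mult_left_eq[OF inner(1)[OF assms(6)]] mult_left_eq[OF inner(2)[OF assms(6)]]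
          mult_left_eq[OF sums(1)[OF assms(5)]] mult_left_eq[OF sums(2)[OF assms(5)]])
        (rule eq_matI; simp del: index_mult_mat(1))
    also have "\<dots> = S * \<Phi> K H i"
      by (simp add: S_def mat_ring dims mult_left_eq[OF outer(3)] mult_left_eq[OF outer(4)]
          mult_left_eq[OF inner(3)[OF assms(5)]] mult_left_eq[OF inner(4)[OF assms(5)]]
          mult_left_eq[OF sums(3)[OF assms(6)]] mult_left_eq[OF sums(4)[OF assms(6)]])
        (rule eq_matI; simp del: index_mult_mat(1))
    finally show ?thesis .
  qed
  have \<Phi>: "\<Phi> H K \<in> \<Omega> (N + N)" "\<Phi> K H \<in> \<Omega> (N + N)" using mem assms(5,6) by (simp_all add: \<Phi>_def N_def)
  note [simp] = mtuplesD(2,3)[OF free_mapD(1)[OF assms(2) N \<Phi>(1)]] mtuplesD(2,3)[OF free_mapD(1)[OF assms(2) N \<Phi>(2)]]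
  have fS: "f (N + N) (\<Phi> H K) j * S = S * f (N + N) (\<Phi> K H) j"
    by (rule free_map_intertwine[OF assms(1,2) N N \<Phi>]) (auto simp: intert intro!: carrier_matI)
  have pq: "p * a = 1\<^sub>m N" "p * b = 0\<^sub>m N N" "q * a = 0\<^sub>m N N" "q * b = 1\<^sub>m N"
    by (simp_all add: abpq)
  have pi: "p1 * i1 = 1\<^sub>m n" "p1 * i2 = 0\<^sub>m n n" "p2 * i1 = 0\<^sub>m n n" "p2 * i2 = 1\<^sub>m n"
    by (simp_all add: ip)
  \<comment> \<open>The permutation fixes the last block column and the first block row, which are
    the ones that cut out the corner.\<close>
  have Sb: "S * (b * i2) = b * i2" and pS: "p1 * p * S = p1 * p"
    by (simp_all add: S_def mat_ring mult_left_eq[OF pq(1)] mult_left_eq[OF pq(2)] mult_left_eq[OF pq(3)]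
        mult_left_eq[OF pq(4)] pi mult_left_eq[OF pi(1)] mult_left_eq[OF pi(2)] mult_left_eq[OF pi(3)] mult_left_eq[OF pi(4)])
  have "p1 * p * (f (N + N) (\<Phi> H K) j * (b * i2)) = p1 * p * (f (N + N) (\<Phi> H K) j * S * (b * i2))"
    by (subst Sb[symmetric]) (simp add: mult_assoc_dim)
  also have "\<dots> = p1 * p * S * (f (N + N) (\<Phi> K H) j * (b * i2))"
    unfolding fS by (simp add: mult_assoc_dim)
  finally have "p1 * p * (f (N + N) (\<Phi> H K) j * (b * i2)) = p1 * p * (f (N + N) (\<Phi> K H) j * (b * i2))"
    by (simp only: pS)
  moreover have "corner H K = p1 * (p * f (N + N) (\<Phi> H K) j * b) * i2"
    "corner K H = p1 * (p * f (N + N) (\<Phi> K H) j * b) * i2"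
    by (simp_all only: corner_def \<Phi>_def abpq ip N_def)
  ultimately show ?thesis by (simp add: mult_assoc_dim)
qed

text \<open>The block matrix of the pair \<open>(X, H)\<close> with corner \<open>(K, 0)\<close> is
  the pair of two block matrices, and the second has zero corner, so it is
  \<open>H \<oplus> H\<close>.\<close>

lemma free_deriv_vector_field:
  assumes "free_set \<Omega>" "free_vector_field \<Omega> T" "analytic_free (times_mtuples \<Omega>) T"
    and "n > 0" "X \<in> \<Omega> n" "H \<in> mtuples n" "K \<in> mtuples n"
  shows "free_deriv T n (tuple_pair X H) (tuple_pair K (tuple_zero n)) =
      (\<lambda>j. fst_mat n n * T (n + n) (tuple_pair (tuple_upper X K X) (tuple_dsum H H)) j * inr_mat n n)"
proof -
  have "tuple_upper H (tuple_zero n) H = tuple_dsum H H"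
    by (simp add: tuple_dsum_upper[OF assms(6,6)] tuple_zero_def)
  moreover have "free_map (times_mtuples \<Omega>) T" using assms(2) by (simp add: free_vector_field_def)
  ultimately show ?thesis
    using free_deriv_upper[OF free_set_times[OF assms(1)] _ assms(3,4), of "tuple_pair X H" "tuple_pair K (tuple_zero n)"]
      assms(5-7) by (simp add: mem_times_mtuples tuple_pair_mtuples tuple_pair_ops)
qed

text \<open>Neighbourhoods are supplied by analyticity on the product set; the zero direction embeds
  \<open>\<Omega>\<close> there, and the first component of the block point is the desired
  one.\<close>

lemma upper_mem_times:
  assumes "free_set \<Omega>" "analytic_free (times_mtuples \<Omega>) (F :: nat \<Rightarrow> _ \<Rightarrow> 'h::finite mtuple)"
    and "n > 0" "X \<in> \<Omega> n" "H \<in> mtuples n"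
  shows "tuple_upper X H X \<in> \<Omega> (n + n)"
proof -
  have "tuple_upper (tuple_pair X (tuple_zero n)) (tuple_pair H (tuple_zero n)) (tuple_pair X (tuple_zero n))
      \<in> times_mtuples \<Omega> (n + n)"
    by (rule upper_mem[OF free_set_times[OF assms(1)] assms(2,3)])
      (use assms in \<open>simp_all add: mem_times_mtuples tuple_pair_mtuples\<close>)
  then show ?thesis by (simp add: tuple_pair_ops mem_times_mtuples)
qed

section \<open>Equivalence of vanishing free curl and existence of a potential\<close>

theorem theorem3p6:
  fixes \<Omega> :: "nat \<Rightarrow> 'g::finite mtuple set"
    and T :: "nat \<Rightarrow> ('g + 'g) mtuple \<Rightarrow> 'h::finite mtuple"
  assumes "free_domain \<Omega>"
    and "connected_free \<Omega>"
    and "free_vector_field \<Omega> T"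
    and "analytic_free (times_mtuples \<Omega>) T"
  shows "free_curl_free \<Omega> T \<longleftrightarrow>
    (\<exists>f :: nat \<Rightarrow> 'g mtuple \<Rightarrow> 'h mtuple.
       free_map \<Omega> f \<and> analytic_free \<Omega> f \<and>
       (\<forall>n>0. \<forall>X\<in>\<Omega> n. \<forall>H\<in>mtuples n. T n (tuple_pair X H) = free_deriv f n X H))"
proof
  have free: "free_set \<Omega>" and op: "\<And>n. n > 0 \<Longrightarrow> openin (tuple_topology n) (\<Omega> n)"
    using assms(1) by (auto simp: free_domain_def)
  note upper = upper_mem_times[OF free assms(4)]
  note deriv = free_deriv_vector_field[OF free assms(3,4)]
  {
    assume curl: "free_curl_free \<Omega> T"
    show "\<exists>f :: nat \<Rightarrow> 'g mtuple \<Rightarrow> 'h mtuple.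
       free_map \<Omega> f \<and> analytic_free \<Omega> f \<and>
       (\<forall>n>0. \<forall>X\<in>\<Omega> n. \<forall>H\<in>mtuples n. T n (tuple_pair X H) = free_deriv f n X H)"
    proof (cases "\<exists>m>0. \<Omega> m \<noteq> {}")
      \<comment> \<open>Without any point there is no base point, but then every family is a
        potential vacuously.\<close>
      case False
      then have "\<Omega> n = {}" if "n > 0" for n using that by blast
      then show ?thesis by (simp add: free_map_def analytic_free_def)
    next
      case True
      then obtain m0 Z0 where base: "m0 > 0" "Z0 \<in> \<Omega> m0" by auto
      interpret based_vf \<Omega> T m0 Z0
      proof unfold_locales
        fix N :: nat and P H K :: "'g mtuple" and j :: 'h assume *: "N > 0" "P \<in> \<Omega> N" "H \<in> mtuples N" "K \<in> mtuples N"
        then have "free_deriv T N (tuple_pair P H) (tuple_pair K (tuple_zero N)) =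
            free_deriv T N (tuple_pair P K) (tuple_pair H (tuple_zero N))"
          using curl by (auto simp: free_curl_free_def)
        then show "fst_mat N N * T (N + N) (tuple_pair (tuple_upper P K P) (tuple_dsum H H)) j * inr_mat N N =
            fst_mat N N * T (N + N) (tuple_pair (tuple_upper P H P) (tuple_dsum K K)) j * inr_mat N N"
          unfolding deriv[OF *] deriv[OF *(1,2,4,3)] by (rule fun_cong)
      qed (use free assms(3) upper base in auto)
      have an: "analytic_free \<Omega> potential"
        by (rule analytic_free_potential[OF op assms(4)])
      have "T n (tuple_pair X H) = free_deriv potential n X H"
        if "n > 0" "X \<in> \<Omega> n" "H \<in> mtuples n" for n X H
        unfolding free_deriv_upper[OF free free_map_potential an that] potential_upper[OF that] ..
      with an free_map_potential show ?thesis by blast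
    qed
  next
    assume "\<exists>f :: nat \<Rightarrow> 'g mtuple \<Rightarrow> 'h mtuple.
       free_map \<Omega> f \<and> analytic_free \<Omega> f \<and>
       (\<forall>n>0. \<forall>X\<in>\<Omega> n. \<forall>H\<in>mtuples n. T n (tuple_pair X H) = free_deriv f n X H)"
    then obtain f :: "nat \<Rightarrow> 'g mtuple \<Rightarrow> 'h mtuple" where f: "free_map \<Omega> f" "analytic_free \<Omega> f"
      and Tf: "\<And>n X H. n > 0 \<Longrightarrow> X \<in> \<Omega> n \<Longrightarrow> H \<in> mtuples n \<Longrightarrow> T n (tuple_pair X H) = free_deriv f n X H"
      by blast
    show "free_curl_free \<Omega> T"
      unfolding free_curl_free_def
    proof (intro allI impI ballI)
      fix n :: nat and X H K :: "'g mtuple" assume n: "n > 0" and X: "X \<in> \<Omega> n" and HK: "H \<in> mtuples n" "K \<in> mtuples n"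
      have mt: "X \<in> mtuples n" using free_setD(1)[OF free n X] .
      have n2: "n + n > 0" using n by simp
      have mem: "tuple_upper (tuple_upper X K X) (tuple_dsum H H) (tuple_upper X K X) \<in> \<Omega> (n + n + (n + n))"
        if "H \<in> mtuples n" "K \<in> mtuples n" for H K
        by (intro upper n2 upper[OF n X that(2)] tuple_dsum_mtuples that)
      \<comment> \<open>At the block point \<open>T\<close> is again a derivative of
        \<open>f\<close>, hence a corner of \<open>f\<close> at a matrix with four by four blocks.
        The outer corner in the formula for \<open>DT\<close> then selects its upper right
        block.\<close>
      have T: "T (n + n) (tuple_pair (tuple_upper X K X) (tuple_dsum H H)) =
          (\<lambda>j. fst_mat (n + n) (n + n) * f (n + n + (n + n))
            (tuple_upper (tuple_upper X K X) (tuple_dsum H H) (tuple_upper X K X)) j * inr_mat (n + n) (n + n))"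
        if "H \<in> mtuples n" "K \<in> mtuples n" for H K
        unfolding Tf[OF n2 upper[OF n X that(2)] tuple_dsum_mtuples[OF that(1,1)]]
        by (rule free_deriv_upper[OF free f n2 upper[OF n X that(2)] tuple_dsum_mtuples[OF that(1,1)]])
      show "free_deriv T n (tuple_pair X H) (tuple_pair K (tuple_zero n)) =
          free_deriv T n (tuple_pair X K) (tuple_pair H (tuple_zero n))"
        unfolding deriv[OF n X HK] deriv[OF n X HK(2,1)] T[OF HK] T[OF HK(2,1)]
        by (rule ext, rule free_map_corner_sym[OF free f(1) n mt HK mem])
    qed
  }
qed

end
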